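(* Let $q\ge5$ be odd with $q\equiv\xi\pmod3$, $\xi\in\{1,-1\}$. The E$\Gamma$-lines form two $G_q$-orbits of size $\frac12(q^3-q)$, and they can be labelled $\mathcal O_1,\mathcal O_2$ so that, writing $\Pi_{\pi,j}$ for the number of $\pi$-planes through any line of $\mathcal O_j$ and $\Lambda_{j,\pi}$ for the number of lines of $\mathcal O_j$ in a $\pi$-plane: $\Pi_{2_{\mathcal C},1}=\Lambda_{1,2_{\mathcal C}}=0$; $\Pi_{2_{\mathcal C},2}=2$, $\Lambda_{2,2_{\mathcal C}}=q-1$; $\Pi_{3_{\mathcal C},1}=\frac16(q-\xi)$; $\Lambda_{1,3_{\mathcal C}}=\Lambda_{1,0_{\mathcal C}}=\Lambda_{2,0_{\mathcal C}}=\frac12(q-\xi)$; $\Pi_{0_{\mathcal C},1}=\Pi_{0_{\mathcal C},2}=\frac13(q-\xi)$; $\Pi_{\overline{1_{\mathcal C}},1}=\Lambda_{1,\overline{1_{\mathcal C}}}=\frac12(q+\xi)$; $\Pi_{\overline{1_{\mathcal C}},2}=\Lambda_{2,\overline{1_{\mathcal C}}}=\frac12(q+\xi-2)$; $\Pi_{3_{\mathcal C},2}=\frac16(q-\xi-6)$, $\Lambda_{2,3_{\mathcal C}}=\frac12(q-\xi-6)$.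
   Context: Let $\mathrm{PG}(3,q)$ have points $\mathbf{P}(x_0,x_1,x_2,x_3)$; put $P(t)=\mathbf{P}(t^3,t^2,t,1)$ ($t\in\mathbb{F}_q$), $P(\infty)=\mathbf{P}(1,0,0,0)$, $\mathcal{C}=\{P(t):t\in\mathbb{F}_q\cup\{\infty\}\}$ the twisted cubic, $G_q$ the group of projectivities fixing $\mathcal C$. Write $\boldsymbol{\pi}(c_0,c_1,c_2,c_3)$ for the plane $c_0x_0+c_1x_1+c_2x_2+c_3x_3=0$. $\Gamma$-planes: osculating planes $\boldsymbol{\pi}(1,-3t,3t^2,-t^3)$ ($t\in\mathbb{F}_q$) and $\boldsymbol{\pi}(0,0,0,1)$. A $d_{\mathcal C}$-plane ($d\in\{0,2,3\}$) contains exactly $d$ points of $\mathcal C$; a $\overline{1_{\mathcal C}}$-plane is a non-$\Gamma$-plane with exactly one point of $\mathcal C$ (each plane type is a $G_q$-orbit for $q\ge5$). A real axis is the intersection line of two distinct $\Gamma$-planes. An E$\Gamma$-line is a line containing no point of $\mathcal C$, lying in some $\Gamma$-plane, which is not a real axis. Known fact: for odd $q\ge5$, $q\not\equiv0\pmod3$, the E$\Gamma$-lines form exactly two $G_q$-orbits, each of size $\frac12(q^3-q)$: the orbits of $\boldsymbol{\pi}(1,0,0,0)\cap\boldsymbol{\pi}(0,-3,0,-1)$ and of $\boldsymbol{\pi}(1,0,0,0)\cap\boldsymbol{\pi}(0,-3\rho,0,-1)$, $\rho$ a non-square in $\mathbb{F}_q$. *)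

theory Defs
  imports "HOL-Analysis.Analysis" "HOL-Number_Theory.Cong"
begin

text \<open>The projective space PG(3,q), with q = CARD('a), consists of the subspaces of the
  four-dimensional vector space over the finite field 'a.  A point, line or plane is a subspace of
  vector dimension 1, 2 or 3, and incidence is inclusion.  The projective coordinates
  $x_0,\ldots,x_3$ of a vector x are x$1, x$2, x$3, x$4.\<close>

definition pg_lines :: "('a::field ^ 4) set set" where
  "pg_lines = {l. vec.subspace l \<and> vec.dim l = 2}"

definition pg_planes :: "('a::field ^ 4) set set" where
  "pg_planes = {\<pi>. vec.subspace \<pi> \<and> vec.dim \<pi> = 3}"

definition pg_point :: "'a::field \<Rightarrow> 'a \<Rightarrow> 'a \<Rightarrow> 'a \<Rightarrow> ('a ^ 4) set" where
  "pg_point x0 x1 x2 x3 = vec.span {vector [x0, x1, x2, x3]}"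

definition pg_plane :: "'a::field \<Rightarrow> 'a \<Rightarrow> 'a \<Rightarrow> 'a \<Rightarrow> ('a ^ 4) set" where
  "pg_plane c0 c1 c2 c3 = {x. c0 * x$1 + c1 * x$2 + c2 * x$3 + c3 * x$4 = 0}"

definition twisted_cubic :: "('a::field ^ 4) set set" where
  "twisted_cubic = insert (pg_point 1 0 0 0) (range (\<lambda>t. pg_point (t^3) (t^2) t 1))"

text \<open>Restricting the domain to the subspaces makes proportional matrices define the same
  projectivity.\<close>

definition projectivities :: "(('a::field ^ 4) set \<Rightarrow> ('a ^ 4) set) set" where
  "projectivities =
     {restrict (\<lambda>S. (\<lambda>v. A *v v) ` S) {S. vec.subspace S} | A :: 'a ^ 4 ^ 4. invertible A}"

definition Gq :: "(('a::field ^ 4) set \<Rightarrow> ('a ^ 4) set) set" where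
  "Gq = {g \<in> projectivities. g ` twisted_cubic = twisted_cubic}"

definition Gq_orbit :: "('a::field ^ 4) set \<Rightarrow> ('a ^ 4) set set" where
  "Gq_orbit S = {g S | g. g \<in> Gq}"

definition Gamma_planes :: "('a::field ^ 4) set set" where
  "Gamma_planes =
     insert (pg_plane 0 0 0 1) (range (\<lambda>t. pg_plane 1 (- 3 * t) (3 * t^2) (- (t^3))))"

definition C_planes :: "nat \<Rightarrow> ('a::field ^ 4) set set" where
  "C_planes d = {\<pi> \<in> pg_planes. card {p \<in> twisted_cubic. p \<subseteq> \<pi>} = d}"

definition bar1_C_planes :: "('a::field ^ 4) set set" where
  "bar1_C_planes = C_planes 1 - Gamma_planes"

definition real_axes :: "('a::field ^ 4) set set" where
  "real_axes = {\<pi> \<inter> \<pi>' | \<pi> \<pi>'. \<pi> \<in> Gamma_planes \<and> \<pi>' \<in> Gamma_planes \<and> \<pi> \<noteq> \<pi>'}"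

definition EGamma_lines :: "('a::field ^ 4) set set" where
  "EGamma_lines = {l \<in> pg_lines. (\<forall>p\<in>twisted_cubic. \<not> p \<subseteq> l) \<and>
                     (\<exists>\<pi>\<in>Gamma_planes. l \<subseteq> \<pi>) \<and> l \<notin> real_axes}"

text \<open>For a class T of planes and a class L of lines, the relations below say that
  $\Pi_{T,L}=r$ and $\Lambda_{L,T}=r$.\<close>

definition Pi_num :: "('a::field ^ 4) set set \<Rightarrow> ('a ^ 4) set set \<Rightarrow> real \<Rightarrow> bool" where
  "Pi_num T L r \<longleftrightarrow> (\<forall>l\<in>L. real (card {\<pi> \<in> T. l \<subseteq> \<pi>}) = r)"

definition Lambda_num :: "('a::field ^ 4) set set \<Rightarrow> ('a ^ 4) set set \<Rightarrow> real \<Rightarrow> bool" where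
  "Lambda_num L T r \<longleftrightarrow> (\<forall>\<pi>\<in>T. real (card {l \<in> L. l \<subseteq> \<pi>}) = r)"

end

theory Submission
  imports Defs
begin

text \<open>A plane \<open>\<pi>(c0, c1, c2, c3)\<close> is the binary cubic \<open>c0 t^3 + c1 t^2 + c2 t + c3\<close> up to a factor, a point
  of the twisted cubic in it is a root of the form, and the \<open>\<Gamma>\<close>-planes are the cubes of linear forms.
  An E\<open>\<Gamma>\<close>-line is a pencil spanned by a cube \<open>L^3\<close> and a form \<open>f\<close> that does not vanish at the root of \<open>L\<close>.
  Moving that root to infinity and translating, the pencil consists of \<open>1\<close> and of the \<open>t^3 + b t + c\<close> for
  one \<open>b \<noteq> 0\<close>, and scaling shows that only the quadratic character of \<open>-3 b\<close> matters; it distinguishes the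
  orbits because \<open>-3 b\<close> is a square iff the pencil contains forms with a double root. The numbers of \<open>c\<close> with a
  given number of roots follow from the first two moments of the number of roots, and comparison with the
  values of the discriminant gives Stickelberger's theorem for cubics.

  For the lines in a plane \<open>f\<close>, each \<open>\<Gamma>\<close>-plane \<open>L^3\<close> cuts \<open>f\<close> in a pencil, whose class is the quadratic
  character of the Hessian of \<open>f\<close> at the root of \<open>L\<close>. Up to squares the discriminant of the Hessian is \<open>-3\<close>
  times that of \<open>f\<close>, so its values are counted by the standard character sum for quadratic polynomials.\<close>

section \<open>Quadratic characters\<close>

text \<open>The sign \<xi> enters as \<open>qchar (-3)\<close>. It first appears in the second
  moment of the number of roots: a second point t with the same value of t^3 + b t as s is a zero of
  t^2 + s t + s^2 + b, whose discriminant -3 s^2 - 4 b has leading coefficient -3. The resulting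
  count of rootless cubics is a third of q - \<open>qchar (-3)\<close>, and its integrality
  identifies \<open>qchar (-3)\<close> with \<xi>. Stickelberger's theorem is needed for planes
  without points of the cubic: the factorization at a root, which links the number of roots to the
  discriminant, says nothing about rootless forms, yet the Hessian count uses the character of their
  discriminant too. On the geometric side the obstacle is that \<open>Gq\<close> is given by its
  effect on points alone. The explicit elements t + s, r t and 1/t suffice for normal forms and
  transitivity, but invariance of the two classes requires every element to permute the
  \<Gamma>-planes. Corrected by explicit elements, an arbitrary one fixes two points of the cubic,
  and the equations of the cubic then force it to be diagonal.\<close>

definition qchar :: "'a::field \<Rightarrow> int" where
  "qchar x = (if x = 0 then 0 else if \<exists>y. x = y^2 then 1 else -1)"

lemma qchar_0 [simp]: "qchar 0 = 0"
  and qchar_eq_0_iff [simp]: "qchar x = 0 \<longleftrightarrow> x = 0"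
  by (auto simp: qchar_def intro: exI[of _ 1])

lemma qchar_values: "qchar x \<in> {-1, 0, 1}"
  by (simp add: qchar_def)

lemma qchar_power2: "qchar (x^2) = (if x = 0 then 0 else 1)"
  by (auto simp: qchar_def)

lemma int_card_eq_sum: "int (card {x::'a::finite. P x}) = (\<Sum>x\<in>UNIV. if P x then 1 else 0)"
  by (simp add: sum.If_cases)

lemma sum_card_fibres:
  fixes f :: "'a::finite \<Rightarrow> 'b::finite"
  shows "(\<Sum>y\<in>UNIV. int (card {x. f x = y})) = int CARD('a)"
proof -
  have "CARD('a) = (\<Sum>y\<in>UNIV. card {x. f x = y})"
    using sum.group[of "UNIV::'a set" "UNIV::'b set" f "\<lambda>_. 1::nat"] by simp
  then show ?thesis by (simp flip: of_nat_sum)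
qed

locale odd_field =
  fixes F :: "'a::{field,finite} itself"
  assumes two: "(2::'a) \<noteq> 0"
begin

text \<open>As 2 is nonzero, y and -y differ for nonzero y. This identity turns counts of solutions
  into character sums and back.\<close>

lemma card_sqrt: "int (card {z::'a. z^2 = a}) = 1 + qchar a"
proof (cases "\<exists>y. a = y^2")
  case True
  then obtain y where y: "a = y^2" by blast
  have eq: "{z. z^2 = a} = {y, -y}"
    using y by (auto simp: power2_eq_iff)
  show ?thesis
  proof (cases "y = 0")
    case False
    have "y \<noteq> -y"
    proof
      assume "y = -y"
      then have "y + y = 0" by (metis add.right_inverse)
      then have "2 * y = 0" by (simp only: mult_2)
      with two False show False by simp
    qed
    with eq False y show ?thesis by (auto simp: qchar_power2)
  qed (use eq y in simp)
next
  case False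
  then have "{z. z^2 = a} = {}" by auto
  with False show ?thesis by (auto simp: qchar_def intro: exI[of _ 0])
qed

lemma sum_qchar: "(\<Sum>x\<in>UNIV. qchar (x::'a)) = 0"
  using sum_card_fibres[of "\<lambda>z::'a. z^2"]
  by (simp add: card_sqrt sum.distrib)

lemma qchar_eq_indicators:
  "qchar x = (if qchar x = 1 then 1 else 0) - (if qchar x = -1 then 1 else 0)"
  using qchar_values[of x] by auto

lemma sum_qchar_eq_card_diff:
  fixes f :: "'b::finite \<Rightarrow> 'a"
  shows "(\<Sum>x\<in>UNIV. qchar (f x)) = int (card {x. qchar (f x) = 1}) - int (card {x. qchar (f x) = -1})"
  unfolding int_card_eq_sum sum_subtractf[symmetric]
  by (rule sum.cong[OF refl]) (rule qchar_eq_indicators)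

lemma card_qchar_partition:
  fixes f :: "'b::finite \<Rightarrow> 'a"
  shows "int (card {x. qchar (f x) = 1}) + int (card {x. qchar (f x) = -1}) + int (card {x. f x = 0})
    = int CARD('b)"
proof -
  have "(\<Sum>x\<in>(UNIV::'b set). 1::int) = (\<Sum>x\<in>UNIV. ((if qchar (f x) = 1 then 1 else 0)
      + (if qchar (f x) = -1 then 1 else 0)) + (if f x = 0 then 1 else 0))"
    by (rule sum.cong[OF refl]) (use qchar_values in \<open>auto simp: qchar_def\<close>)
  then show ?thesis unfolding int_card_eq_sum sum.distrib by simp
qed

lemma card_qchar_pm1:
  "2 * int (card {x::'a. qchar x = 1}) = int CARD('a) - 1"
  "2 * int (card {x::'a. qchar x = -1}) = int CARD('a) - 1"
proof -
  have "{x::'a. x = 0} = {0}" by auto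
  then show "2 * int (card {x::'a. qchar x = 1}) = int CARD('a) - 1"
  "2 * int (card {x::'a. qchar x = -1}) = int CARD('a) - 1"
    using sum_qchar_eq_card_diff[of "\<lambda>x::'a. x"] card_qchar_partition[of "\<lambda>x::'a. x"] sum_qchar
    by simp_all
qed

text \<open>The case of two nonsquares is the point: multiplication by a nonsquare maps the nonzero
  squares injectively into the nonsquares. Both sets have the same size, so the image is all
  nonsquares, and no nonsquare can be mapped to a nonsquare.\<close>

lemma qchar_mult: "qchar (x * y) = qchar x * qchar (y::'a)"
proof -
  have sq: "qchar (x * y) = qchar y" if "qchar x = 1" for x y :: 'a
  proof -
    from that obtain z where z: "x = z^2" "z \<noteq> 0"
      by (auto simp: qchar_def split: if_splits)
    have "(\<exists>w. x * y = w^2) \<longleftrightarrow> (\<exists>w. y = w^2)"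
    proof
      assume "\<exists>w. x * y = w^2"
      then obtain w where "x * y = w^2" ..
      then have "y = (w / z)^2" using z by (simp add: field_simps)
      then show "\<exists>w. y = w^2" ..
    next
      assume "\<exists>w. y = w^2"
      then obtain w where "y = w^2" ..
      then have "x * y = (z * w)^2" using z by (simp add: power_mult_distrib)
      then show "\<exists>w. x * y = w^2" ..
    qed
    then show ?thesis using z by (simp add: qchar_def)
  qed
  consider "qchar x = 1" | "qchar y = 1" | "x = 0" | "y = 0" | "qchar x = -1" "qchar y = -1"
    using qchar_values[of x] qchar_values[of y] by auto
  then show ?thesis
  proof cases
    case 5
    let ?Q = "{y::'a. qchar y = 1}" and ?N = "{y::'a. qchar y = -1}"
    have x: "x \<noteq> 0" using 5 by auto
    have "(*) x ` ?Q \<subseteq> ?N"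
      using 5 sq by (auto simp: mult.commute[of x])
    moreover have "card ((*) x ` ?Q) = card ?Q"
      using x by (intro card_image) (auto simp: inj_on_def)
    moreover have "card ?Q = card ?N" using card_qchar_pm1 by simp
    ultimately have im: "(*) x ` ?Q = ?N"
      by (intro card_subset_eq) auto
    have "qchar (x * y) \<noteq> -1"
    proof
      assume "qchar (x * y) = -1"
      then have "x * y \<in> (*) x ` ?Q" using im by auto
      then show False using x 5 by auto
    qed
    moreover have "x * y \<noteq> 0" using 5 by auto
    ultimately show ?thesis using 5 qchar_values[of "x * y"] by auto
  qed (use sq[of x y] sq[of y x] in \<open>auto simp: mult.commute\<close>)
qed

lemma qchar_4 [simp]: "qchar (4::'a) = 1"
  using qchar_power2[of "2::'a"] two by simp

text \<open>Up to the summand q, the sum counts the affine points of the conic z^2 = x^2 + k. It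
  factors as (z - x)(z + x) = k, so u = z + x runs through the nonzero elements and determines the
  point, which gives q - 1 points.\<close>

lemma sum_qchar_power2_plus:
  assumes "k \<noteq> (0::'a)"
  shows "(\<Sum>x\<in>UNIV. qchar (x^2 + k)) = -1"
proof -
  have "int CARD('a) + (\<Sum>x\<in>UNIV. qchar (x^2 + k)) = (\<Sum>x\<in>UNIV. int (card {z. z^2 = x^2 + k}))"
    by (simp add: card_sqrt sum.distrib)
  also have "\<dots> = int (card (SIGMA x:UNIV. {z. z^2 = x^2 + k}))"
    by simp
  also have "card (SIGMA x:UNIV. {z. z^2 = x^2 + k}) = card (UNIV - {0::'a})"
  proof (rule bij_betw_same_card)
    let ?f = "\<lambda>(x, z). z + x :: 'a" and ?g = "\<lambda>u. ((u - k / u) / 2, (u + k / u) / 2)"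
    have f: "z + x \<noteq> 0 \<and> k / (z + x) = z - x" if "z^2 = x^2 + k" for x z
    proof -
      from that have *: "k = (z - x) * (z + x)" by (simp add: algebra_simps power2_eq_square)
      with assms have "z + x \<noteq> 0" by auto
      with * show ?thesis by simp
    qed
    have half: "(z + x - (z - x)) / 2 = x" "(z + x + (z - x)) / 2 = z" for x z :: 'a
    proof -
      have "z + x - (z - x) = x * 2" "z + x + (z - x) = z * 2" by simp_all
      with two show "(z + x - (z - x)) / 2 = x" "(z + x + (z - x)) / 2 = z" by simp_all
    qed
    have g: "((u + k / u) / 2)^2 = ((u - k / u) / 2)^2 + k" if "u \<noteq> 0" for u
    proof -
      have "(u + k / u)^2 = (u - k / u)^2 + k * 4"
        using that by (simp add: power2_eq_square algebra_simps)
      moreover have "(2::'a)^2 = 4" "(4::'a) \<noteq> 0" using qchar_4 by fastforce+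
      ultimately have "(u + k / u)^2 / 2^2 = (u - k / u)^2 / 2^2 + k"
        by (simp add: add_divide_distrib del: power2_diff)
      then show ?thesis by (simp only: power_divide)
    qed
    show "bij_betw ?f (SIGMA x:UNIV. {z. z^2 = x^2 + k}) (UNIV - {0})"
    proof (rule bij_betw_byWitness[where f' = ?g])
      show "\<forall>p\<in>SIGMA x:UNIV. {z. z^2 = x^2 + k}. ?g (?f p) = p"
      proof
        fix p assume "p \<in> (SIGMA x:UNIV. {z. z^2 = x^2 + k})"
        then obtain x z where p: "p = (x, z)" "z^2 = x^2 + k" by auto
        then show "?g (?f p) = p" using f[OF p(2)] half[of z x] by (simp only: case_prod_conv)
      qed
      show "\<forall>u\<in>UNIV - {0}. ?f (?g u) = u"
      proof
        fix u :: 'a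
        have "?f (?g u) = (u + k / u + (u - k / u)) / 2" by (simp only: case_prod_conv add_divide_distrib)
        then show "?f (?g u) = u" using two by simp
      qed
      show "?f ` (SIGMA x:UNIV. {z. z^2 = x^2 + k}) \<subseteq> UNIV - {0}"
        using f by auto
      show "?g ` (UNIV - {0}) \<subseteq> (SIGMA x:UNIV. {z. z^2 = x^2 + k})"
        using g by blast
    qed
  qed
  also have "int (card (UNIV - {0::'a})) = int CARD('a) - 1"
    by (simp add: card_Diff_subset of_nat_diff Suc_leI)
  finally show ?thesis by simp
qed

text \<open>Completing the square: \<open>4 * \<alpha>\<close> times the polynomial is the square of
  a bijective linear function minus the discriminant. As 4 is a square, the factor
  \<open>qchar \<alpha>\<close> comes out, and being 1 or -1 it is its own inverse.\<close>

lemma sum_qchar_quadratic: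
  assumes "\<alpha> \<noteq> (0::'a)" "\<beta>^2 - 4 * \<alpha> * \<gamma> \<noteq> 0"
  shows "(\<Sum>x\<in>UNIV. qchar (\<alpha> * x^2 + \<beta> * x + \<gamma>)) = - qchar \<alpha>"
proof -
  have bij: "bij_betw (\<lambda>x. 2 * \<alpha> * x + \<beta>) UNIV UNIV"
    using assms two by (intro bij_betw_byWitness[where f' = "\<lambda>y. (y - \<beta>) / (2 * \<alpha>)"]) auto
  have *: "(2 * \<alpha> * x + \<beta>)^2 + - (\<beta>^2 - 4 * \<alpha> * \<gamma>) = 4 * (\<alpha> * (\<alpha> * x^2 + \<beta> * x + \<gamma>))" for x
    by (simp add: power2_eq_square algebra_simps)
  have "-1 = (\<Sum>x\<in>UNIV. qchar ((2 * \<alpha> * x + \<beta>)^2 + - (\<beta>^2 - 4 * \<alpha> * \<gamma>)))"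
    using sum_qchar_power2_plus[of "- (\<beta>^2 - 4 * \<alpha> * \<gamma>)"] assms
      sum.reindex_bij_betw[OF bij, of "\<lambda>y. qchar (y^2 + - (\<beta>^2 - 4 * \<alpha> * \<gamma>))"]
    by simp
  also have "\<dots> = qchar \<alpha> * (\<Sum>x\<in>UNIV. qchar (\<alpha> * x^2 + \<beta> * x + \<gamma>))"
    unfolding * by (simp only: qchar_mult qchar_4 sum_distrib_left mult_1)
  finally show ?thesis using assms(1) qchar_values[of \<alpha>] by auto
qed

lemma card_quadratic_roots:
  "int (card {x::'a. x^2 + \<beta> * x + \<gamma> = 0}) = 1 + qchar (\<beta>^2 - 4 * \<gamma>)"
proof -
  have four: "(4::'a) \<noteq> 0" using qchar_4 by fastforce
  have "(2 * x + \<beta>)^2 - (\<beta>^2 - 4 * \<gamma>) = 4 * (x^2 + \<beta> * x + \<gamma>)" for x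
    by (simp add: power2_eq_square algebra_simps)
  then have *: "x^2 + \<beta> * x + \<gamma> = 0 \<longleftrightarrow> (2 * x + \<beta>)^2 = \<beta>^2 - 4 * \<gamma>" for x
    using four by (metis eq_iff_diff_eq_0 mult_eq_0_iff)
  have "bij_betw (\<lambda>x. 2 * x + \<beta>) {x. x^2 + \<beta> * x + \<gamma> = 0} {z. z^2 = \<beta>^2 - 4 * \<gamma>}"
    unfolding *
  proof (intro bij_betw_byWitness[where f' = "\<lambda>y. (y - \<beta>) / 2"])
    have "2 * ((y - \<beta>) / 2) + \<beta> = y" for y
      using nonzero_mult_div_cancel_left[OF two, of "y - \<beta>"]
      by (simp only: times_divide_eq_right diff_add_cancel)
    then show "\<forall>y\<in>{z. z^2 = \<beta>^2 - 4 * \<gamma>}. 2 * ((y - \<beta>) / 2) + \<beta> = y"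
      "(\<lambda>y. (y - \<beta>) / 2) ` {z. z^2 = \<beta>^2 - 4 * \<gamma>} \<subseteq> {x. (2 * x + \<beta>)^2 = \<beta>^2 - 4 * \<gamma>}"
      by (simp_all add: image_subset_iff)
  qed (use two in auto)
  then show ?thesis using card_sqrt by (simp add: bij_betw_same_card)
qed

end

section \<open>Cubics over a finite field\<close>

text \<open>Both sides count the pairs of arguments with the same image.\<close>

lemma sum_card_fibres_power2:
  fixes f :: "'a::finite \<Rightarrow> 'b::finite"
  shows "(\<Sum>y\<in>UNIV. (int (card {x. f x = y}))^2) = (\<Sum>x\<in>UNIV. int (card {x'. f x' = f x}))"
proof -
  have "(\<Sum>y\<in>UNIV. (int (card {x. f x = y}))^2)
    = (\<Sum>y\<in>UNIV. \<Sum>x | f x = y. int (card {x'. f x' = f x}))"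
    by (rule sum.cong) (auto simp: power2_eq_square)
  also have "\<dots> = (\<Sum>x\<in>UNIV. int (card {x'. f x' = f x}))"
    using sum.group[of "UNIV::'a set" "UNIV::'b set" f "\<lambda>x. int (card {x'. f x' = f x})"] by simp
  finally show ?thesis .
qed

definition cubic_roots :: "'a::field \<Rightarrow> 'a \<Rightarrow> 'a set" where
  "cubic_roots b c = {t. t^3 + b * t + c = 0}"

definition cubic_disc :: "'a::field \<Rightarrow> 'a \<Rightarrow> 'a" where
  "cubic_disc b c = - (4 * b^3 + 27 * c^2)"

text \<open>A root r splits off the cofactor t^2 + r t + r^2 + b. The two factors are the
  discriminant of this cofactor and the square of its value \<open>3 * r^2 + b\<close> at r, which
  is also the derivative of the cubic there.\<close>

lemma cubic_disc_at_root:
  assumes "r \<in> cubic_roots b c"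
  shows "cubic_disc b c = (r^2 - 4 * (r^2 + b)) * (3 * r^2 + b)^2"
proof -
  from assms have c: "c = - (r^3 + b * r)"
    by (simp add: cubic_roots_def add_eq_0_iff)
  show ?thesis unfolding c cubic_disc_def
    by (simp add: power2_eq_square power3_eq_cube algebra_simps)
qed

lemma cubic_roots_eq_insert:
  assumes "r \<in> cubic_roots b c"
  shows "cubic_roots b c = insert r {t. t^2 + r * t + (r^2 + b) = 0}"
proof -
  from assms have c: "c = - (r^3 + b * r)"
    by (simp add: cubic_roots_def add_eq_0_iff)
  have "t^3 + b * t + c = (t - r) * (t^2 + r * t + (r^2 + b))" for t
    unfolding c by (simp add: power2_eq_square power3_eq_cube algebra_simps)
  then show ?thesis by (auto simp: cubic_roots_def)
qed

locale cubic_field = odd_field F for F :: "'a::{field,finite} itself" +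
  assumes three: "(3::'a) \<noteq> 0"
begin

lemma numerals_nonzero [simp]:
  "(2::'a) \<noteq> 0" "(3::'a) \<noteq> 0" "(4::'a) \<noteq> 0" "(9::'a) \<noteq> 0"
  "(27::'a) \<noteq> 0" "(48::'a) \<noteq> 0" "(81::'a) \<noteq> 0" "(432::'a) \<noteq> 0"
proof -
  have "(4::'a) = 2^2" "(9::'a) = 3^2" "(27::'a) = 3^3" "(48::'a) = 2^4 * 3"
    "(81::'a) = 3^4" "(432::'a) = 2^4 * 3^3"
    by simp_all
  then show "(2::'a) \<noteq> 0" "(3::'a) \<noteq> 0" "(4::'a) \<noteq> 0" "(9::'a) \<noteq> 0"
    "(27::'a) \<noteq> 0" "(48::'a) \<noteq> 0" "(81::'a) \<noteq> 0" "(432::'a) \<noteq> 0"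
    using two three by (metis mult_eq_0_iff power_not_zero)+
qed

lemma qchar_mult_power2: "y \<noteq> 0 \<Longrightarrow> qchar (x * y^2) = qchar (x::'a)"
  by (simp add: qchar_mult qchar_power2)

text \<open>At a simple root the discriminant of the quadratic cofactor has the square class of
  \<open>cubic_disc b c\<close>. The second assumption excludes t^3, whose discriminant is 0 but
  which has a single root.\<close>

lemma card_cubic_roots:
  fixes b c :: 'a
  assumes "cubic_roots b c \<noteq> {}" "b \<noteq> 0 \<or> c \<noteq> 0"
  shows "int (card (cubic_roots b c)) = 2 + qchar (cubic_disc b c)"
proof -
  obtain r where r: "r \<in> cubic_roots b c" using assms by blast
  let ?Q = "{t. t^2 + r * t + (r^2 + b) = 0}"
  have Q: "int (card ?Q) = 1 + qchar (r^2 - 4 * (r^2 + b))" by (rule card_quadratic_roots)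
  have rQ: "r \<in> ?Q \<longleftrightarrow> 3 * r^2 + b = 0" by (simp add: power2_eq_square algebra_simps)
  show ?thesis
  proof (cases "3 * r^2 + b = 0")
    case False
    then have "card (cubic_roots b c) = Suc (card ?Q)"
      using rQ unfolding cubic_roots_eq_insert[OF r] by (intro card_insert_disjoint) auto
    with Q False show ?thesis
      unfolding cubic_disc_at_root[OF r] by (simp add: qchar_mult_power2)
  next
    \<comment> \<open>Here r is a multiple root: the cofactor has discriminant
      \<open>(3 * r)^2\<close>, a nonzero square, and its two roots already include r.\<close>
    case True
    then have b: "b = - (3 * r^2)" by (simp add: eq_neg_iff_add_eq_0 add.commute)
    have "r \<noteq> 0" using assms(2) r b by (auto simp: cubic_roots_def)
    then have "qchar ((3 * r)^2) = 1" unfolding qchar_power2 by simp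
    moreover have "r^2 - 4 * (r^2 + b) = (3 * r)^2"
      unfolding b by (simp add: power2_eq_square)
    moreover have "cubic_roots b c = ?Q"
      using True rQ unfolding cubic_roots_eq_insert[OF r] by auto
    ultimately show ?thesis using Q True
      unfolding cubic_disc_at_root[OF r] by simp
  qed
qed

lemma cubic_roots_if_disc_0:
  fixes b c :: 'a
  assumes "b \<noteq> 0" "cubic_disc b c = 0"
  obtains d where "d \<noteq> 0" "b = - (3 * d^2)" "cubic_roots b c = {d, -2 * d}"
proof
  \<comment> \<open>A double root satisfies t^3 + b t + c = 0 and 3 t^2 + b = 0; eliminating the
    cube leaves 2 b t + 3 c = 0.\<close>
  define d where "d = - (3 * c) / (2 * b)"
  have bd: "2 * b * d = - (3 * c)" using assms(1) by (simp add: d_def)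
  have "4 * b^2 * (3 * d^2 + b) = 3 * (2 * b * d)^2 + 4 * b^3"
    by (simp add: power2_eq_square power3_eq_cube algebra_simps)
  also have "\<dots> = - cubic_disc b c"
    unfolding bd by (simp add: cubic_disc_def power2_eq_square)
  finally show b: "b = - (3 * d^2)" using assms by (simp add: add_eq_0_iff)
  with assms(1) show "d \<noteq> 0" by auto
  have "3 * c = - (2 * b * d)" using bd by simp
  also have "\<dots> = 3 * (2 * d^3)"
    unfolding b by (simp add: power2_eq_square power3_eq_cube)
  finally have "3 * c = 3 * (2 * d^3)" .
  then have c: "c = 2 * d^3" using three by (simp only: mult_cancel_left) simp
  have "t^3 + b * t + c = (t - d)^2 * (t + 2 * d)" for t
    unfolding b c by (simp add: power2_eq_square power3_eq_cube algebra_simps)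
  then show "cubic_roots b c = {d, -2 * d}"
    by (auto simp: cubic_roots_def add_eq_0_iff)
qed

lemma cubic_roots_nonempty_if_disc_0:
  fixes b c :: 'a
  assumes "b \<noteq> 0" "cubic_disc b c = 0"
  shows "cubic_roots b c \<noteq> {}"
  using cubic_roots_if_disc_0[OF assms] by blast

lemma card_cubic_roots_values:
  fixes b c :: 'a
  assumes "b \<noteq> 0 \<or> c \<noteq> 0"
  shows "card (cubic_roots b c) \<in> {0, 1, 2, 3}"
  using card_cubic_roots[OF _ assms] qchar_values[of "cubic_disc b c"]
  by (cases "cubic_roots b c = {}") auto

lemma card_cubic_roots_eq_2_iff:
  fixes b c :: 'a
  assumes "b \<noteq> 0"
  shows "card (cubic_roots b c) = 2 \<longleftrightarrow> cubic_disc b c = 0"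
  using card_cubic_roots[of b c] cubic_roots_nonempty_if_disc_0[of b c] assms
  by (cases "cubic_roots b c = {}") auto

section \<open>Moments of the number of roots as the constant term varies\<close>

lemma sum_card_cubic_roots: "(\<Sum>c\<in>UNIV. int (card (cubic_roots b (c::'a)))) = int CARD('a)"
proof -
  have "cubic_roots b c = {t. - (t^3 + b * t) = c}" for c
    by (auto simp: cubic_roots_def add_eq_0_iff)
  then show ?thesis using sum_card_fibres[of "\<lambda>t. - (t^3 + b * t)"] by simp
qed

lemma card_disc_eq_0:
  assumes "b \<noteq> (0::'a)"
  shows "int (card {c. cubic_disc b c = 0}) = 1 + qchar (-3 * b)"
proof -
  have "cubic_disc b c = -27 * (c^2 + 0 * c + 4 * b^3 / 27)" for c
    by (simp add: cubic_disc_def field_simps)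
  then have "cubic_disc b c = 0 \<longleftrightarrow> c^2 + 0 * c + 4 * b^3 / 27 = 0" for c
    by (simp only: mult_eq_0_iff) simp
  then have "int (card {c. cubic_disc b c = 0}) = 1 + qchar (0^2 - 4 * (4 * b^3 / 27))"
    by (simp only: card_quadratic_roots)
  also have "0^2 - 4 * (4 * b^3 / 27) = -3 * b * (4 * b / 9)^2"
    by (simp add: power2_eq_square power3_eq_cube field_simps)
  also have "qchar (-3 * b * (4 * b / 9)^2) = qchar (-3 * b)"
    using assms by (intro qchar_mult_power2) simp
  finally show ?thesis .
qed

text \<open>These s are the multiple roots of the cubics t^3 + b t + c with varying c; they form the
  overlap correction in the second moment.\<close>

lemma card_double_points:
  assumes "b \<noteq> (0::'a)"
  shows "int (card {s. 3 * s^2 + b = 0}) = 1 + qchar (-3 * b)"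
proof -
  have "3 * s^2 + b = 0 \<longleftrightarrow> s^2 + 0 * s + b / 3 = 0" for s
    by (simp add: field_simps)
  then have "int (card {s. 3 * s^2 + b = 0}) = 1 + qchar (0^2 - 4 * (b / 3))"
    by (simp only: card_quadratic_roots)
  also have "0^2 - 4 * (b / 3) = -3 * b * (2 / 3)^2"
    by (simp add: power2_eq_square field_simps)
  also have "qchar (-3 * b * (2 / 3)^2) = qchar (-3 * b)"
    using assms by (intro qchar_mult_power2) simp
  finally show ?thesis .
qed

text \<open>The sum counts pairs (s, t) at which t^3 + b t takes the same value. For given s these t
  are s itself and the zeros of the cofactor, counted through its discriminant -3 s^2 - 4 b; the
  last term corrects for those s that are zeros of their own cofactor.\<close>

lemma sum_card_cubic_roots_power2:
  assumes "b \<noteq> (0::'a)"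
  shows "(\<Sum>c\<in>UNIV. (int (card (cubic_roots b (c::'a))))^2)
    = 2 * int CARD('a) - qchar (-3::'a) - (1 + qchar (-3 * b))"
proof -
  have "cubic_roots b c = {t. - (t^3 + b * t) = c}" for c
    by (auto simp: cubic_roots_def add_eq_0_iff)
  then have "(\<Sum>c\<in>UNIV. (int (card (cubic_roots b (c::'a))))^2)
    = (\<Sum>s\<in>UNIV. int (card {t. - (t^3 + b * t) = - (s^3 + b * s)}))"
    using sum_card_fibres_power2[of "\<lambda>t. - (t^3 + b * t)"] by simp
  also have "\<dots> = (\<Sum>s\<in>UNIV. 2 + qchar (-3 * s^2 + 0 * s + -4 * b) - (if 3 * s^2 + b = 0 then 1 else 0))"
  proof (rule sum.cong[OF refl])
    fix s :: 'a
    let ?c = "- (s^3 + b * s)" and ?Q = "{t. t^2 + s * t + (s^2 + b) = 0}"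
    have s: "s \<in> cubic_roots b ?c" by (simp add: cubic_roots_def)
    have "{t. - (t^3 + b * t) = ?c} = cubic_roots b ?c"
      by (auto simp: cubic_roots_def eq_neg_iff_add_eq_0 add_eq_0_iff)
    also have "\<dots> = insert s ?Q" by (rule cubic_roots_eq_insert[OF s])
    also have "int (card (insert s ?Q)) = 1 + int (card ?Q) - (if 3 * s^2 + b = 0 then 1 else 0)"
    proof -
      have "s \<in> ?Q \<longleftrightarrow> 3 * s^2 + b = 0" by (simp add: power2_eq_square algebra_simps)
      then show ?thesis by (simp add: card_insert_if)
    qed
    also have "int (card ?Q) = 1 + qchar (s^2 - 4 * (s^2 + b))" by (rule card_quadratic_roots)
    also have "s^2 - 4 * (s^2 + b) = -3 * s^2 + 0 * s + -4 * b" by (simp add: algebra_simps)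
    finally show "int (card {t. - (t^3 + b * t) = ?c})
      = 2 + qchar (-3 * s^2 + 0 * s + -4 * b) - (if 3 * s^2 + b = 0 then 1 else 0)" by simp
  qed
  also have "\<dots> = 2 * int CARD('a) + (\<Sum>s\<in>UNIV. qchar (-3 * s^2 + 0 * s + -4 * b))
      - int (card {s. 3 * s^2 + b = 0})"
    unfolding int_card_eq_sum by (simp add: sum.distrib sum_subtractf)
  also have "(\<Sum>s\<in>UNIV. qchar (-3 * s^2 + 0 * s + -4 * b)) = - qchar (-3::'a)"
    using assms by (intro sum_qchar_quadratic) auto
  finally show ?thesis using card_double_points[OF assms] by simp
qed

text \<open>\<open>N 2\<close> counts the zeros of the discriminant in c. The number of all c and
  the first two moments then give three linear equations for the other three unknowns.\<close>

lemma cubic_counts: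
  assumes b: "b \<noteq> (0::'a)"
  defines "N \<equiv> \<lambda>d. int (card {c. card (cubic_roots b c) = d})"
  shows "N 2 = 1 + qchar (-3 * b)"
    and "6 * N 3 = int CARD('a) - qchar (-3::'a) - 3 * N 2"
    and "2 * N 1 = int CARD('a) + qchar (-3::'a) - N 2"
    and "3 * N 0 = int CARD('a) - qchar (-3::'a)"
proof -
  have v: "card (cubic_roots b c) \<in> {0, 1, 2, 3}" for c
    using b card_cubic_roots_values by blast
  have sum: "(\<Sum>c\<in>UNIV. g (card (cubic_roots b c))) = g 0 * N 0 + g 1 * N 1 + g 2 * N 2 + g 3 * N 3"
    for g :: "nat \<Rightarrow> int"
  proof -
    have "(\<Sum>c\<in>UNIV. g (card (cubic_roots b c))) = (\<Sum>c\<in>UNIV.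
        g 0 * (if card (cubic_roots b c) = 0 then 1 else 0) + g 1 * (if card (cubic_roots b c) = 1 then 1 else 0)
      + g 2 * (if card (cubic_roots b c) = 2 then 1 else 0) + g 3 * (if card (cubic_roots b c) = 3 then 1 else 0))"
      by (rule sum.cong[OF refl]) (use v in force)
    then show ?thesis unfolding N_def int_card_eq_sum sum.distrib sum_distrib_left .
  qed
  show N2: "N 2 = 1 + qchar (-3 * b)"
    unfolding N_def card_cubic_roots_eq_2_iff[OF b] by (rule card_disc_eq_0[OF b])
  have "N 0 + N 1 + N 2 + N 3 = int CARD('a)" using sum[of "\<lambda>_. 1"] by simp
  moreover have "N 1 + 2 * N 2 + 3 * N 3 = int CARD('a)"
    using sum[of int] sum_card_cubic_roots[of b] by simp
  moreover have "N 1 + 4 * N 2 + 9 * N 3 = 2 * int CARD('a) - qchar (-3::'a) - N 2"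
    using sum[of "\<lambda>d. (int d)^2"] sum_card_cubic_roots_power2[OF b] N2 by simp
  ultimately show "6 * N 3 = int CARD('a) - qchar (-3::'a) - 3 * N 2"
    "2 * N 1 = int CARD('a) + qchar (-3::'a) - N 2" "3 * N 0 = int CARD('a) - qchar (-3::'a)"
    by linarith+
qed

text \<open>The number of c for which t^3 + t + c has no root is an integer, and three times it is
  the difference of the two sides.\<close>

lemma qchar_minus_3_cong: "[int CARD('a) = qchar (-3::'a)] (mod 3)"
  using cubic_counts(4)[of "1::'a"] unfolding cong_iff_dvd_diff
  by (metis dvd_triv_left zero_neq_one)

lemma qchar_minus_27_mult:
  assumes "c \<noteq> (0::'a)"
  shows "qchar (- (27 * c^2)) = qchar (-3::'a)"
proof -
  from assms have "qchar (-3 * (3 * c)^2) = qchar (-3::'a)" by (intro qchar_mult_power2) simp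
  then show ?thesis by (simp add: power_mult_distrib)
qed

text \<open>Stickelberger's theorem for cubics. For fixed \<^term>\<open>b \<noteq> 0\<close> there are as many \<^term>\<open>c\<close> with
  nonsquare discriminant as cubics with exactly one root, so no rootless cubic is left among the former.\<close>

lemma qchar_disc_if_no_roots:
  fixes b c :: 'a
  assumes "cubic_roots b c = {}"
  shows "qchar (cubic_disc b c) = 1"
proof (cases "b = 0")
  case False
  let ?A = "{c. card (cubic_roots b c) = 1}" and ?B = "{c. qchar (cubic_disc b c) = -1}"
  have d: "cubic_disc b c = -27 * c^2 + 0 * c + - (4 * b^3)" for c
    by (simp add: cubic_disc_def)
  have "(\<Sum>c\<in>UNIV. qchar (cubic_disc b c)) = - qchar (-27::'a)"
    unfolding d using False by (intro sum_qchar_quadratic) auto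
  then have "int (card {c. qchar (cubic_disc b c) = 1}) - int (card ?B) = - qchar (-3::'a)"
    using sum_qchar_eq_card_diff[of "cubic_disc b"] qchar_minus_27_mult[of 1] by simp
  moreover have "int (card {c. qchar (cubic_disc b c) = 1}) + int (card ?B)
      + int (card {c. cubic_disc b c = 0}) = int CARD('a)"
    by (rule card_qchar_partition)
  \<comment> \<open>Twice either count is q + \<open>qchar (-3)\<close> minus the number of zeros of
    the discriminant.\<close>
  ultimately have "int (card ?A) = int (card ?B)"
    using cubic_counts(1,3)[OF False] card_disc_eq_0[OF False] by simp
  moreover have "?A \<subseteq> ?B"
  proof
    fix c assume "c \<in> ?A"
    then have "int (card (cubic_roots b c)) = 1" by simp
    moreover have "cubic_roots b c \<noteq> {}" using \<open>c \<in> ?A\<close> by auto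
    ultimately show "c \<in> ?B" using card_cubic_roots[of b c] False by simp
  qed
  ultimately have "?A = ?B" by (intro card_subset_eq) auto
  moreover have "c \<notin> ?A" using assms by simp
  moreover have "cubic_disc b c \<noteq> 0" using cubic_roots_nonempty_if_disc_0[OF False] assms by auto
  ultimately show ?thesis using qchar_values[of "cubic_disc b c"] by auto
next
  case True
  have c: "c \<noteq> 0" using assms True by (auto simp: cubic_roots_def intro: exI[of _ 0])
  \<comment> \<open>If -3 were a nonsquare, t^2 + s t + s^2 would have no zero for nonzero s, so
    cubing would be injective, hence onto, and t^3 + c would have a root. So -3 is a square, and
    with it the discriminant -27 c^2.\<close>
  have "qchar (-3::'a) = 1"
  proof (rule ccontr)
    assume "qchar (-3::'a) \<noteq> 1"
    then have X: "qchar (-3::'a) = -1" using qchar_values[of "-3::'a"] by auto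
    have "inj (\<lambda>t::'a. t^3)"
    proof (rule injI, rule ccontr)
      fix s t :: 'a assume *: "s^3 = t^3" "s \<noteq> t"
      have "(t - s) * (t^2 + s * t + s^2) = t^3 - s^3"
        by (simp add: power2_eq_square power3_eq_cube algebra_simps)
      with * have "t \<in> {t. t^2 + s * t + s^2 = 0}" by simp
      then have "int (card {t. t^2 + s * t + s^2 = 0}) \<noteq> 0" by (auto simp: card_eq_0_iff)
      then have "qchar (s^2 - 4 * s^2) \<noteq> -1" unfolding card_quadratic_roots by simp
      moreover have "s^2 - 4 * s^2 = -3 * s^2" by simp
      moreover have "s \<noteq> 0" using * by auto
      ultimately show False using X qchar_mult_power2[of s "-3"] by metis
    qed
    then have "surj (\<lambda>t::'a. t^3)" by (rule finite_UNIV_inj_surj[OF finite])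
    then obtain t where "-c = t^3" by (metis surjD)
    then have "t^3 + c = 0" by (metis add.left_inverse)
    with assms True show False by (auto simp: cubic_roots_def)
  qed
  with c True show ?thesis using qchar_minus_27_mult[of c] by (simp add: cubic_disc_def)
qed

section \<open>The Hessian of a depressed cubic and its character on the projective line\<close>

definition hess :: "'a \<Rightarrow> 'a \<Rightarrow> 'a \<Rightarrow> 'a" where
  "hess b c s = -3 * b * s^2 + -9 * c * s + b^2"

text \<open>The Hessian of \<open>t^3 + b t + c\<close>, up to a constant factor, is a binary quadratic form, dehomogenized
  in \<^term>\<open>hess\<close>. The first summand of the counts below is its value \<^term>\<open>-3 * b\<close> at infinity.\<close>

definition hess_count :: "int \<Rightarrow> 'a \<Rightarrow> 'a \<Rightarrow> int" where
  "hess_count i b c = (if qchar (-3 * b) = i then 1 else 0) + int (card {s. qchar (hess b c s) = i})"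

lemma hess_discriminant: "(-9 * c)^2 - 4 * (-3 * b) * b^2 = -3 * cubic_disc b c"
  by (simp add: cubic_disc_def power2_eq_square power3_eq_cube algebra_simps)

text \<open>With f = t^3 + b t + c the Hessian is f'(s)^2 - 9 s f(s). So its character is 1 at a
  simple root of f and 0 at a multiple one, never -1.\<close>

lemma hess_at_root:
  assumes "s \<in> cubic_roots b c"
  shows "hess b c s = (3 * s^2 + b)^2"
proof -
  from assms have c: "c = - (s^3 + b * s)"
    by (simp add: cubic_roots_def add_eq_0_iff)
  show ?thesis unfolding c hess_def
    by (simp add: power2_eq_square power3_eq_cube algebra_simps)
qed

text \<open>On the q + 1 points of the projective line the character of a nondegenerate binary
  quadratic form sums to 0, so the values 1 and -1 share equally what the zeros leave. The number of
  zeros is 1 plus the character of the discriminant \<open>-3 * cubic_disc b c\<close>.\<close>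

lemma hess_count_disc_nonzero:
  assumes "cubic_disc b c \<noteq> 0" and i: "i \<in> {1, -1}"
  shows "2 * hess_count i b c = int CARD('a) - qchar (-3::'a) * qchar (cubic_disc b c)"
proof -
  let ?S = "\<lambda>i. int (card {s. qchar (hess b c s) = i})" and ?Z = "int (card {s. hess b c s = 0})"
  have sum: "?S 1 + ?S (-1) + ?Z = int CARD('a)"
    by (rule card_qchar_partition)
  have diff: "?S 1 - ?S (-1) = - qchar (-3 * b)"
  proof (cases "b = 0")
    case False
    then show ?thesis
      unfolding sum_qchar_eq_card_diff[of "hess b c", symmetric] unfolding hess_def
      using assms(1) hess_discriminant[of c b] by (intro sum_qchar_quadratic) auto
  next
    case True
    with assms have "c \<noteq> 0" by (auto simp: cubic_disc_def)
    then have bij: "bij_betw (\<lambda>s. -9 * c * s) UNIV UNIV"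
      by (intro bij_betw_byWitness[where f' = "\<lambda>y. y / (-9 * c)"]) auto
    show ?thesis
      unfolding sum_qchar_eq_card_diff[of "hess b c", symmetric]
      using True sum.reindex_bij_betw[OF bij, of qchar] sum_qchar by (simp add: hess_def)
  qed
  \<comment> \<open>\<open>?Z\<close> counts finite zeros only; for b = 0 the leading coefficient
    vanishes and infinity is the missing zero.\<close>
  have zeros: "?Z = 1 + qchar (-3::'a) * qchar (cubic_disc b c) - (if b = 0 then 1 else 0)"
  proof (cases "b = 0")
    case False
    have "hess b c s = 0 \<longleftrightarrow> s^2 + (3 * c / b) * s + - b / 3 = 0" for s
    proof -
      have "hess b c s = (-3 * b) * (s^2 + (3 * c / b) * s + - b / 3)"
        using False by (simp add: hess_def field_simps power2_eq_square)
      then show ?thesis using False by simp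
    qed
    then have "?Z = 1 + qchar ((3 * c / b)^2 - 4 * (- b / 3))"
      by (simp only: card_quadratic_roots)
    also have "(3 * c / b)^2 - 4 * (- b / 3) = (-3 * cubic_disc b c) * (1 / (3 * b))^2"
      unfolding hess_discriminant[symmetric]
      using False by (simp add: field_simps power2_eq_square)
    also have "qchar \<dots> = qchar (-3 * cubic_disc b c)"
      using False by (intro qchar_mult_power2) simp
    finally show ?thesis using False by (simp only: qchar_mult) simp
  next
    case True
    with assms have c: "c \<noteq> 0" by (auto simp: cubic_disc_def)
    with True have "{s. hess b c s = 0} = {0}" by (auto simp: hess_def)
    moreover have "qchar (-3::'a) * qchar (cubic_disc b c) = 1"
      using True qchar_minus_27_mult[OF c] qchar_values[of "-3::'a"] by (auto simp: cubic_disc_def)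
    ultimately show ?thesis using True by simp
  qed
  consider "b = 0" "qchar (-3 * b) = 0" | "b \<noteq> 0" "qchar (-3 * b) = 1" | "b \<noteq> 0" "qchar (-3 * b) = -1"
    using qchar_values[of "-3 * b"] by fastforce
  then show ?thesis
    using sum diff zeros i unfolding hess_count_def by cases (auto simp del: mult_minus_left)
qed

text \<open>The Hessian degenerates to \<open>-3 * b\<close> times the square of a linear form, and
  \<open>-3 * b\<close> is itself a nonzero square. So the character is 1 at all points but the
  double zero.\<close>

lemma hess_count_disc_0:
  assumes "cubic_disc b c = 0" "b \<noteq> 0"
  shows "hess_count 1 b c = int CARD('a)" "hess_count (-1) b c = 0"
proof -
  \<comment> \<open>The double zero of the Hessian, which is also the double root of the
    cubic.\<close>
  define s0 where "s0 = - (3 * c) / (2 * b)"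
  have c: "27 * c^2 = - (4 * b^3)"
    using assms(1) by (simp add: cubic_disc_def add_eq_0_iff)
  have "4 * b * hess b c s = -3 * (2 * b * s + 3 * c)^2" for s
  proof -
    have "4 * b * hess b c s = -3 * (2 * b * s + 3 * c)^2 + 27 * c^2 + 4 * b^3"
      by (simp add: hess_def power2_eq_square power3_eq_cube algebra_simps)
    then show ?thesis using c by simp
  qed
  note h4 = this
  have h: "hess b c s = -3 * b * (s - s0)^2" for s
  proof -
    have "4 * b * (-3 * b * (s - s0)^2) = -3 * (2 * b * s + 3 * c)^2"
      using assms(2) by (simp add: s0_def field_simps power2_eq_square)
    with h4[of s] have "4 * b * hess b c s = 4 * b * (-3 * b * (s - s0)^2)"
      by simp
    moreover have "4 * b \<noteq> 0" using assms(2) by simp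
    ultimately show ?thesis using mult_left_cancel by blast
  qed
  have "c \<noteq> 0" using c assms by auto
  \<comment> \<open>This is the vanishing of the discriminant, 27 c^2 = -4 b^3, solved for -3
    b.\<close>
  moreover have "-3 * b = (9 * c / (2 * b))^2"
  proof -
    have "(9 * c / (2 * b))^2 = 3 * (27 * c^2) / (4 * b^2)"
      by (simp add: power2_eq_square)
    also have "\<dots> = -3 * b"
      unfolding c using assms(2) by (simp add: power2_eq_square power3_eq_cube)
    finally show ?thesis by simp
  qed
  ultimately have b: "qchar (-3 * b) = 1" using assms(2) by (simp only: qchar_power2) simp
  have q: "qchar (hess b c s) = (if s = s0 then 0 else 1)" for s
    unfolding h using b qchar_mult_power2[of "s - s0" "-3 * b"] by (cases "s = s0") auto
  have "{s. qchar (hess b c s) = 1} = UNIV - {s0}" unfolding q by auto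
  then have "int (card {s. qchar (hess b c s) = 1}) = int CARD('a) - 1"
    by (simp add: card_Diff_subset of_nat_diff Suc_leI)
  then show "hess_count 1 b c = int CARD('a)" unfolding hess_count_def using b by simp
  have "{s. qchar (hess b c s) = -1} = {}" unfolding q by auto
  then show "hess_count (-1) b c = 0" unfolding hess_count_def using b by simp
qed

text \<open>This will be the number of lines of class i in \<open>pg_plane 1 0 b c\<close>. The
  first summand stands for \<open>Gamma_inf\<close>, the argument s for \<open>Gamma_at s\<close>;
  roots are left out because there the line of intersection contains the point \<open>P_at s\<close>
  of the cubic.\<close>

definition pencil_count :: "int \<Rightarrow> 'a \<Rightarrow> 'a \<Rightarrow> int" where
  "pencil_count i b c = (if qchar (-3 * b) = i then 1 else 0)
    + int (card {s. s \<notin> cubic_roots b c \<and> qchar (hess b c s) = i})"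

lemma pencil_count_minus_1: "pencil_count (-1) b c = hess_count (-1) b c"
proof -
  have "{s. s \<notin> cubic_roots b c \<and> qchar (hess b c s) = -1} = {s. qchar (hess b c s) = -1}"
    using hess_at_root by (auto simp: qchar_power2 split: if_splits)
  then show ?thesis by (simp add: pencil_count_def hess_count_def)
qed

text \<open>Only simple roots are lost: the Hessian is a nonzero square there and 0 at multiple
  roots.\<close>

lemma pencil_count_1:
  "pencil_count 1 b c = hess_count 1 b c - int (card {s \<in> cubic_roots b c. 3 * s^2 + b \<noteq> 0})"
proof -
  have "{s. qchar (hess b c s) = 1} = {s. s \<notin> cubic_roots b c \<and> qchar (hess b c s) = 1}
      \<union> {s \<in> cubic_roots b c. 3 * s^2 + b \<noteq> 0}"
    using hess_at_root by (auto simp: qchar_power2)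
  moreover have "card \<dots> = card {s. s \<notin> cubic_roots b c \<and> qchar (hess b c s) = 1}
      + card {s \<in> cubic_roots b c. 3 * s^2 + b \<noteq> 0}"
    by (intro card_Un_disjoint) auto
  ultimately show ?thesis by (simp add: pencil_count_def hess_count_def)
qed

lemma simple_roots_if_disc_nonzero:
  assumes "cubic_disc b c \<noteq> (0::'a)"
  shows "{s \<in> cubic_roots b c. 3 * s^2 + b \<noteq> 0} = cubic_roots b c"
  using assms cubic_disc_at_root by fastforce

lemma pencil_counts:
  fixes b c :: 'a
  assumes nz: "b \<noteq> 0 \<or> c \<noteq> 0"
  defines "r \<equiv> card (cubic_roots b c)" and "q \<equiv> int CARD('a)" and "X \<equiv> qchar (-3::'a)"
  shows "r = 0 \<Longrightarrow> 2 * pencil_count 1 b c = q - X"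
    and "r = 0 \<Longrightarrow> 2 * pencil_count (-1) b c = q - X"
    and "r = 1 \<Longrightarrow> 2 * pencil_count 1 b c = q + X - 2"
    and "r = 1 \<Longrightarrow> 2 * pencil_count (-1) b c = q + X"
    and "r = 2 \<Longrightarrow> pencil_count 1 b c = q - 1"
    and "r = 2 \<Longrightarrow> pencil_count (-1) b c = 0"
    and "r = 3 \<Longrightarrow> 2 * pencil_count 1 b c = q - X - 6"
    and "r = 3 \<Longrightarrow> 2 * pencil_count (-1) b c = q - X"
proof -
  \<comment> \<open>The value r - 2 comes from the factorization at a root; r = 0 needs
    Stickelberger's theorem.\<close>
  have chi: "qchar (cubic_disc b c) = (if r = 0 then 1 else int r - 2)"
    using card_cubic_roots[OF _ nz] qchar_disc_if_no_roots[of b c]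
    by (auto simp: r_def card_eq_0_iff)
  have ne: "2 * pencil_count 1 b c = q - X * qchar (cubic_disc b c) - 2 * int r
    \<and> 2 * pencil_count (-1) b c = q - X * qchar (cubic_disc b c)" if "r \<noteq> 2"
  proof -
    have "qchar (cubic_disc b c) \<noteq> 0" using chi that by auto
    then have "cubic_disc b c \<noteq> 0" by simp
    then show ?thesis unfolding pencil_count_minus_1 pencil_count_1
      using hess_count_disc_nonzero[of b c 1] hess_count_disc_nonzero[of b c "-1"]
      by (simp add: simple_roots_if_disc_nonzero r_def q_def X_def)
  qed
  show "r = 0 \<Longrightarrow> 2 * pencil_count 1 b c = q - X"
    "r = 0 \<Longrightarrow> 2 * pencil_count (-1) b c = q - X"
    "r = 1 \<Longrightarrow> 2 * pencil_count 1 b c = q + X - 2"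
    "r = 1 \<Longrightarrow> 2 * pencil_count (-1) b c = q + X"
    "r = 3 \<Longrightarrow> 2 * pencil_count 1 b c = q - X - 6"
    "r = 3 \<Longrightarrow> 2 * pencil_count (-1) b c = q - X"
    using ne chi by auto
  have two: "pencil_count 1 b c = q - 1 \<and> pencil_count (-1) b c = 0" if "r = 2"
  proof -
    have d: "cubic_disc b c = 0" using chi that by simp
    have b: "b \<noteq> 0"
    proof
      assume "b = 0"
      with d have "c = 0" by (simp add: cubic_disc_def)
      with nz \<open>b = 0\<close> show False by simp
    qed
    obtain e where e: "e \<noteq> 0" "b = - (3 * e^2)" "cubic_roots b c = {e, -2 * e}"
      using cubic_roots_if_disc_0[OF b d] .
    have pair: "{s \<in> {x, y}. P s} = {y}" if "\<not> P x" "P y" for x y and P :: "'a \<Rightarrow> bool"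
      using that by blast
    \<comment> \<open>The Hessian vanishes at the double root e, which is therefore not among the q
      points counted; only the simple root -2 e is subtracted.\<close>
    have "3 * e^2 + b = 0" "3 * (-2 * e)^2 + b = 9 * e^2"
      unfolding e(2) by (simp_all add: power_mult_distrib)
    moreover have "9 * e^2 \<noteq> 0" using e(1) by simp
    ultimately have "\<not> (3 * e^2 + b \<noteq> 0)" "3 * (-2 * e)^2 + b \<noteq> 0" by metis+
    then have "{s \<in> cubic_roots b c. 3 * s^2 + b \<noteq> 0} = {-2 * e}"
      unfolding e(3) by (rule pair)
    then show ?thesis unfolding pencil_count_minus_1 pencil_count_1
      using hess_count_disc_0[OF d b] by (simp add: q_def)
  qed
  then show "r = 2 \<Longrightarrow> pencil_count 1 b c = q - 1" "r = 2 \<Longrightarrow> pencil_count (-1) b c = 0" by auto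
qed

end

section \<open>Subspaces of the four-dimensional space\<close>

lemma vector_4 [simp]:
  "(vector [x, y, z, w] :: 'a::zero^4) $ 1 = x"
  "(vector [x, y, z, w] :: 'a::zero^4) $ 2 = y"
  "(vector [x, y, z, w] :: 'a::zero^4) $ 3 = z"
  "(vector [x, y, z, w] :: 'a::zero^4) $ 4 = w"
  unfolding vector_def by simp_all

lemma vec_eq_iff_4: "(x :: 'a^4) = y \<longleftrightarrow> x$1 = y$1 \<and> x$2 = y$2 \<and> x$3 = y$3 \<and> x$4 = y$4"
  by (simp add: vec_eq_iff forall_4)

lemma matrix_vector_mult_4:
  "(A *v x :: 'a::semiring_1^4) $ i = A$i$1 * x$1 + A$i$2 * x$2 + A$i$3 * x$3 + A$i$4 * (x::'a^4)$4"
  by (simp add: matrix_vector_mult_def sum_4)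

lemma mem_pg_plane [simp]: "x \<in> pg_plane c0 c1 c2 c3 \<longleftrightarrow> c0 * x$1 + c1 * x$2 + c2 * x$3 + c3 * x$4 = 0"
  by (simp add: pg_plane_def)

lemma dim_UNIV_4: "vec.dim (UNIV :: ('a::field^4) set) = 4"
  by (simp add: vec_dim_card del: vec.dim_UNIV)

lemma subspace_pg_plane: "vec.subspace (pg_plane c0 c1 c2 c3 :: ('a::field^4) set)"
proof (rule vec.subspaceI)
  fix k :: 'a and x y :: "'a^4"
  assume x: "x \<in> pg_plane c0 c1 c2 c3"
  have "c0 * (k * x$1) + c1 * (k * x$2) + c2 * (k * x$3) + c3 * (k * x$4)
      = k * (c0 * x$1 + c1 * x$2 + c2 * x$3 + c3 * x$4)"
    by (simp add: algebra_simps)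
  with x show "k *s x \<in> pg_plane c0 c1 c2 c3" by simp
  assume "y \<in> pg_plane c0 c1 c2 c3"
  moreover have "c0 * (x$1 + y$1) + c1 * (x$2 + y$2) + c2 * (x$3 + y$3) + c3 * (x$4 + y$4)
      = (c0 * x$1 + c1 * x$2 + c2 * x$3 + c3 * x$4) + (c0 * y$1 + c1 * y$2 + c2 * y$3 + c3 * y$4)"
    by (simp add: algebra_simps)
  ultimately show "x + y \<in> pg_plane c0 c1 c2 c3" using x by simp
qed simp

text \<open>A vector v violating the equation spans a complement, so the dimension is 4 - 1.\<close>

lemma pg_plane_in_pg_planes:
  assumes "c0 \<noteq> 0 \<or> c1 \<noteq> 0 \<or> c2 \<noteq> 0 \<or> c3 \<noteq> (0::'a::field)"
  shows "pg_plane c0 c1 c2 c3 \<in> pg_planes"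
proof -
  let ?P = "pg_plane c0 c1 c2 c3" and ?f = "\<lambda>x::'a^4. c0 * x$1 + c1 * x$2 + c2 * x$3 + c3 * x$4"
  have "\<exists>v. ?f v \<noteq> 0"
    using assms
  proof (elim disjE)
    assume "c0 \<noteq> 0" then show ?thesis by (intro exI[of _ "vector [1,0,0,0]"]) simp
  next
    assume "c1 \<noteq> 0" then show ?thesis by (intro exI[of _ "vector [0,1,0,0]"]) simp
  next
    assume "c2 \<noteq> 0" then show ?thesis by (intro exI[of _ "vector [0,0,1,0]"]) simp
  next
    assume "c3 \<noteq> 0" then show ?thesis by (intro exI[of _ "vector [0,0,0,1]"]) simp
  qed
  then obtain v where v: "?f v \<noteq> 0" ..
  have fs: "?f (k *s x) = k * ?f x" and fd: "?f (x - y) = ?f x - ?f y" for k x y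
    by (simp_all add: algebra_simps)
  have "?P \<inter> vec.span {v} = {0}"
    using v fs by (auto simp: vec.span_singleton)
  moreover have "{x + y |x y. x \<in> ?P \<and> y \<in> vec.span {v}} = UNIV"
  proof (intro equalityI subset_UNIV subsetI)
    fix x :: "'a^4"
    let ?k = "?f x / ?f v"
    have "?f (x - ?k *s v) = 0" unfolding fd fs using v by simp
    then have "x - ?k *s v \<in> ?P" unfolding mem_pg_plane .
    moreover have "?k *s v \<in> vec.span {v}" by (auto simp: vec.span_singleton)
    ultimately show "x \<in> {x + y |x y. x \<in> ?P \<and> y \<in> vec.span {v}}"
      by (intro CollectI exI[of _ "x - ?k *s v"] exI[of _ "?k *s v"]) simp
  qed
  moreover have "v \<noteq> 0" using v by auto
  ultimately have "vec.dim ?P = 3"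
    using vec.dim_sums_Int[OF subspace_pg_plane[of c0 c1 c2 c3] vec.subspace_span[of "{v}"]]
    by (simp add: dim_UNIV_4 del: vec.dim_UNIV mem_pg_plane)
  then show ?thesis by (simp add: pg_planes_def subspace_pg_plane)
qed

text \<open>Extend a basis of \<pi> by a vector v outside and take a linear map that kills the basis
  and sends v to the first unit vector. The first row of its matrix is the equation sought.\<close>

lemma pg_planes_cases:
  assumes "\<pi> \<in> pg_planes"
  obtains c0 c1 c2 c3 :: "'a::field" where "\<pi> = pg_plane c0 c1 c2 c3"
    "c0 \<noteq> 0 \<or> c1 \<noteq> 0 \<or> c2 \<noteq> 0 \<or> c3 \<noteq> 0"
proof -
  from assms have sub: "vec.subspace \<pi>" and dim: "vec.dim \<pi> = 3" by (auto simp: pg_planes_def)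
  obtain B where B: "B \<subseteq> \<pi>" "vec.independent B" "\<pi> \<subseteq> vec.span B" "card B = 3"
    using vec.basis_exists[of \<pi>] dim by metis
  have \<pi>: "\<pi> = vec.span B" using B sub vec.span_minimal by blast
  have "\<pi> \<noteq> UNIV" using dim dim_UNIV_4[where 'a='a] by (auto simp del: vec.dim_UNIV)
  then obtain v where v: "v \<notin> vec.span B" using \<pi> by auto
  then have "vec.independent (insert v B)" using B(2) by (simp add: vec.independent_insert)
  then obtain g where g: "Vector_Spaces.linear (*s) (*s) g"
    "\<forall>x\<in>insert v B. g x = (if x = v then axis 1 1 else 0 :: 'a^4)"
    using vec.linear_independent_extend[of "insert v B" "\<lambda>x. if x = v then axis 1 1 else 0"] by blast
  define A where "A = matrix g"
  have A: "A *v x = g x" for x unfolding A_def by (rule matrix_works[OF g(1)])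
  have gB: "g x = 0" if "x \<in> B" for x
    using g(2) v that vec.span_base by auto
  have "g x = 0" if "x \<in> \<pi>" for x
    using vec.linear_eq_0_on_span[OF g(1), of B x] gB that \<pi> by blast
  then have sub2: "\<pi> \<subseteq> pg_plane (A$1$1) (A$1$2) (A$1$3) (A$1$4)"
    unfolding A[symmetric] by (auto simp: vec_eq_iff_4 matrix_vector_mult_4)
  have "(A *v v) $ 1 \<noteq> 0" unfolding A using g(2) by (simp add: axis_def)
  then have nz: "A$1$1 \<noteq> 0 \<or> A$1$2 \<noteq> 0 \<or> A$1$3 \<noteq> 0 \<or> A$1$4 \<noteq> 0"
    unfolding matrix_vector_mult_4 by auto
  have "\<pi> = pg_plane (A$1$1) (A$1$2) (A$1$3) (A$1$4)"
    using vec.subspace_dim_equal[OF sub subspace_pg_plane sub2] pg_plane_in_pg_planes[OF nz] dim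
    by (simp add: pg_planes_def)
  then show thesis using nz by (rule that)
qed

lemma pg_plane_scale:
  assumes "k \<noteq> (0::'a::field)"
  shows "pg_plane (k * c0) (k * c1) (k * c2) (k * c3) = pg_plane c0 c1 c2 c3"
proof -
  have "k * c0 * x$1 + k * c1 * x$2 + k * c2 * x$3 + k * c3 * x$4
    = k * (c0 * x$1 + c1 * x$2 + c2 * x$3 + c3 * x$4)" for x :: "'a^4"
    by (simp add: algebra_simps)
  then show ?thesis using assms by auto
qed

text \<open>Each minor comes from a test vector on the second plane, such as
  \<open>vector [d1, -d0, 0, 0]\<close>.\<close>

lemma pg_plane_eq_imp_proportional:
  assumes "pg_plane c0 c1 c2 c3 = pg_plane d0 d1 d2 (d3::'a::field)"
  shows "c0 * d1 = c1 * d0" "c0 * d2 = c2 * d0" "c0 * d3 = c3 * d0"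
    "c1 * d2 = c2 * d1" "c1 * d3 = c3 * d1" "c2 * d3 = c3 * d2"
proof -
  have *: "x \<in> pg_plane c0 c1 c2 c3" if "x \<in> pg_plane d0 d1 d2 d3" for x
    using assms that by simp
  show "c0 * d1 = c1 * d0" using *[of "vector [d1, -d0, 0, 0]"] by simp
  show "c0 * d2 = c2 * d0" using *[of "vector [d2, 0, -d0, 0]"] by simp
  show "c0 * d3 = c3 * d0" using *[of "vector [d3, 0, 0, -d0]"] by simp
  show "c1 * d2 = c2 * d1" using *[of "vector [0, d2, -d1, 0]"] by simp
  show "c1 * d3 = c3 * d1" using *[of "vector [0, d3, 0, -d1]"] by simp
  show "c2 * d3 = c3 * d2" using *[of "vector [0, 0, d3, -d2]"] by simp
qed

lemma pg_planes_Int_in_pg_lines: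
  assumes "\<pi> \<in> pg_planes" "\<pi>' \<in> pg_planes" "\<pi> \<noteq> (\<pi>' :: ('a::field^4) set)"
  shows "\<pi> \<inter> \<pi>' \<in> pg_lines"
proof -
  from assms have s: "vec.subspace \<pi>" "vec.subspace \<pi>'" and d: "vec.dim \<pi> = 3" "vec.dim \<pi>' = 3"
    by (auto simp: pg_planes_def)
  let ?S = "{x + y |x y. x \<in> \<pi> \<and> y \<in> \<pi>'}"
  have S: "vec.subspace ?S" by (rule vec.subspace_sums[OF s])
  have sub: "\<pi> \<subseteq> ?S" "\<pi>' \<subseteq> ?S"
    using vec.subspace_0[OF s(1)] vec.subspace_0[OF s(2)] by force+
  have "vec.dim ?S \<noteq> 3"
  proof
    assume "vec.dim ?S = 3"
    then have "\<pi> = ?S" "\<pi>' = ?S"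
      using vec.subspace_dim_equal[OF s(1) S sub(1)] vec.subspace_dim_equal[OF s(2) S sub(2)] d by auto
    with assms(3) show False by simp
  qed
  moreover have "vec.dim ?S \<ge> 3" using vec.dim_subset[OF sub(1)] d by simp
  moreover have "vec.dim ?S \<le> 4" using vec.dim_subset[OF subset_UNIV[of ?S]] unfolding dim_UNIV_4 .
  ultimately have "vec.dim ?S = 4" by linarith
  then have "vec.dim (\<pi> \<inter> \<pi>') = 2"
    using vec.dim_sums_Int[OF s] d by simp
  then show ?thesis using s by (simp add: pg_lines_def vec.subspace_inter)
qed

lemma pg_line_eq_Int:
  assumes "l \<in> pg_lines" "l \<subseteq> \<pi>" "l \<subseteq> \<pi>'" "\<pi> \<in> pg_planes" "\<pi>' \<in> pg_planes" "\<pi> \<noteq> \<pi>'"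
  shows "l = \<pi> \<inter> (\<pi>' :: ('a::field^4) set)"
  using vec.subspace_dim_equal[of l "\<pi> \<inter> \<pi>'"] pg_planes_Int_in_pg_lines[OF assms(4-6)] assms(1-3)
  by (auto simp: pg_lines_def)

lemma span_singleton_subset_iff:
  "vec.subspace S \<Longrightarrow> vec.span {v :: 'a::field^'n} \<subseteq> S \<longleftrightarrow> v \<in> S"
  using vec.span_minimal[of "{v}" S] vec.span_base[of v "{v}"] by blast

lemma pg_point_subset_pg_plane_iff [simp]:
  "pg_point x0 x1 x2 x3 \<subseteq> pg_plane c0 c1 c2 c3 \<longleftrightarrow> c0 * x0 + c1 * x1 + c2 * x2 + c3 * x3 = 0"
  unfolding pg_point_def by (simp add: span_singleton_subset_iff subspace_pg_plane)

lemma subspace_pg_point: "vec.subspace (pg_point x0 x1 x2 x3)"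
  unfolding pg_point_def by (rule vec.subspace_span)

section \<open>Points and osculating planes of the twisted cubic\<close>

abbreviation P_inf :: "('a::field^4) set" where "P_inf \<equiv> pg_point 1 0 0 0"

abbreviation P_at :: "'a::field \<Rightarrow> ('a^4) set" where "P_at t \<equiv> pg_point (t^3) (t^2) t 1"

abbreviation Gamma_inf :: "('a::field^4) set" where "Gamma_inf \<equiv> pg_plane 0 0 0 1"

abbreviation Gamma_at :: "'a::field \<Rightarrow> ('a^4) set" where
  "Gamma_at t \<equiv> pg_plane 1 (- 3 * t) (3 * t^2) (- (t^3))"

lemma P_at_inject [simp]: "P_at s = P_at t \<longleftrightarrow> s = (t::'a::field)"
proof
  assume "P_at s = P_at t"
  then have "P_at s \<subseteq> pg_plane 0 0 1 (-t)" by simp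
  then show "s = t" by simp
qed simp

lemma P_at_neq_P_inf [simp]: "P_at t \<noteq> (P_inf :: ('a::field^4) set)" "P_inf \<noteq> P_at t"
proof -
  have "P_at t \<noteq> P_inf"
  proof
    assume "P_at t = P_inf"
    then have "P_at t \<subseteq> pg_plane 0 0 0 1" by simp
    then show False by simp
  qed
  then show "P_at t \<noteq> P_inf" "P_inf \<noteq> P_at t" by auto
qed

lemma pg_point_scale:
  assumes "k \<noteq> (0::'a::field)"
  shows "pg_point (k * x0) (k * x1) (k * x2) (k * x3) = pg_point x0 x1 x2 x3"
proof -
  have "vector [k * x0, k * x1, k * x2, k * x3] = k *s (vector [x0, x1, x2, x3] :: 'a^4)"
    by (simp add: vec_eq_iff_4)
  then show ?thesis unfolding pg_point_def
    using assms vec.span_image_scale[of "{vector [x0, x1, x2, x3]}" "\<lambda>_. k"] by simp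
qed

text \<open>A vanishing leading coefficient is a root at infinity, that is, the point
  \<open>P_inf\<close>.\<close>

lemma card_C_points_in_plane:
  fixes c0 :: "'a::{field,finite}"
  shows "card {p \<in> twisted_cubic. p \<subseteq> pg_plane c0 c1 c2 c3}
    = card {t. c0 * t^3 + c1 * t^2 + c2 * t + c3 = 0} + (if c0 = 0 then 1 else 0)"
proof -
  let ?R = "{t. c0 * t^3 + c1 * t^2 + c2 * t + c3 = 0}"
  have "{p \<in> insert a (range f). Q p} = (if Q a then insert a (f ` {t. Q (f t)}) else f ` {t. Q (f t)})"
    for a :: "('a^4) set" and f :: "'a \<Rightarrow> ('a^4) set" and Q
    by auto
  then have "{p \<in> twisted_cubic. p \<subseteq> pg_plane c0 c1 c2 c3} = (if c0 = 0 then insert P_inf (P_at ` ?R) else P_at ` ?R)"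
    unfolding twisted_cubic_def by simp
  moreover have "card (P_at ` ?R) = card ?R" by (intro card_image) (simp add: inj_on_def)
  moreover have "P_inf \<notin> P_at ` ?R" by auto
  ultimately show ?thesis by auto
qed

section \<open>Matrices acting on subspaces, and the stabilizer of the cubic\<close>

abbreviation act :: "'a::field^4^4 \<Rightarrow> ('a^4) set \<Rightarrow> ('a^4) set" where
  "act A S \<equiv> (*v) A ` S"

lemma act_mult: "act (A ** B) S = act A (act B S)"
  by (simp add: image_image matrix_vector_mul_assoc)

lemma inj_matrix_vector_mult: "invertible (A::'a::field^'n^'n) \<Longrightarrow> inj ((*v) A)"
  using invertible_left_inverse matrix_left_invertible_injective by blast

lemma inj_act: "invertible A \<Longrightarrow> act A S = act A T \<longleftrightarrow> S = T"
  using inj_matrix_vector_mult inj_image_eq_iff by blast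

lemma act_subset_iff: "invertible A \<Longrightarrow> act A S \<subseteq> act A T \<longleftrightarrow> S \<subseteq> T"
  using inj_matrix_vector_mult inj_image_subset_iff by blast

lemma invertibleI: "(\<And>x. A *v x = 0 \<Longrightarrow> x = 0) \<Longrightarrow> invertible (A::'a::field^'n^'n)"
  using invertible_left_inverse matrix_left_invertible_ker by blast

lemma subspace_act: "vec.subspace S \<Longrightarrow> vec.subspace (act A S)"
  by (rule vec.linear_subspace_image) simp_all

lemma dim_act: "invertible A \<Longrightarrow> vec.dim (act A S) = vec.dim S"
  using inj_matrix_vector_mult by (intro vec.dim_image_eq) (auto intro: inj_on_subset)

lemma act_pg_planes: "invertible A \<Longrightarrow> \<pi> \<in> pg_planes \<Longrightarrow> act A \<pi> \<in> pg_planes"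
  and act_pg_lines: "invertible A \<Longrightarrow> l \<in> pg_lines \<Longrightarrow> act A l \<in> pg_lines"
  by (simp_all add: pg_planes_def pg_lines_def subspace_act dim_act)

lemma act_pg_plane_eqI:
  assumes "invertible A" "c0 \<noteq> 0 \<or> c1 \<noteq> 0 \<or> c2 \<noteq> 0 \<or> c3 \<noteq> 0" "d0 \<noteq> 0 \<or> d1 \<noteq> 0 \<or> d2 \<noteq> 0 \<or> d3 \<noteq> 0"
    and "\<And>x. x \<in> pg_plane c0 c1 c2 c3 \<Longrightarrow> A *v x \<in> pg_plane d0 d1 d2 d3"
  shows "act A (pg_plane c0 c1 c2 c3) = pg_plane d0 d1 d2 d3"
proof -
  have "act A (pg_plane c0 c1 c2 c3) \<subseteq> pg_plane d0 d1 d2 d3" using assms(4) by blast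
  then show ?thesis
    using vec.subspace_dim_equal[of "act A (pg_plane c0 c1 c2 c3)" "pg_plane d0 d1 d2 d3"]
      act_pg_planes[OF assms(1) pg_plane_in_pg_planes[OF assms(2)]] pg_plane_in_pg_planes[OF assms(3)]
    by (simp add: pg_planes_def)
qed

lemma act_pg_point: "act A (vec.span {v}) = vec.span {A *v v}"
  using vec.linear_span_image[of "(*v) A" "{v}"] by simp

text \<open>Matrices are easier to compose and invert than the restricted maps in \<open>Gq\<close>;
  \<open>Gq_orbit_eq\<close> shows that they give the same orbits.\<close>

definition cubic_stab :: "('a::field^4^4) set" where
  "cubic_stab = {A. invertible A \<and> act A ` twisted_cubic = twisted_cubic}"

lemma cubic_stab_invertible: "A \<in> cubic_stab \<Longrightarrow> invertible A"
  and cubic_stab_image: "A \<in> cubic_stab \<Longrightarrow> act A ` twisted_cubic = twisted_cubic"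
  by (simp_all add: cubic_stab_def)

text \<open>Over a finite field an injective map of the cubic into itself is onto.\<close>

lemma cubic_stabI:
  assumes "invertible A" "\<And>p. p \<in> twisted_cubic \<Longrightarrow> act A p \<in> twisted_cubic"
  shows "A \<in> (cubic_stab :: ('a::{field,finite}^4^4) set)"
proof -
  have "act A ` twisted_cubic = twisted_cubic"
    using assms by (intro endo_inj_surj) (auto simp: inj_on_def inj_act)
  with assms(1) show ?thesis by (simp add: cubic_stab_def)
qed

lemma cubic_stab_mult: "A \<in> cubic_stab \<Longrightarrow> B \<in> cubic_stab \<Longrightarrow> A ** B \<in> cubic_stab"
  by (auto simp: cubic_stab_def invertible_mult act_mult simp flip: image_image)

lemma matrix_inv_inverse:
  assumes "invertible A"
  shows "A ** matrix_inv A = mat 1" "matrix_inv A ** A = mat 1"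
  using someI_ex[OF assms[unfolded invertible_def]] unfolding matrix_inv_def by auto

lemma act_matrix_inv [simp]: "invertible A \<Longrightarrow> act (matrix_inv A) (act A S) = S"
    "invertible A \<Longrightarrow> act A (act (matrix_inv A) S) = S"
  by (simp_all add: matrix_inv_inverse flip: act_mult)

lemma matrix_inv_cubic_stab: "A \<in> cubic_stab \<Longrightarrow> matrix_inv A \<in> cubic_stab"
proof -
  assume A: "A \<in> cubic_stab"
  then have inv: "invertible A" by (rule cubic_stab_invertible)
  have "invertible (matrix_inv A)" using matrix_inv_inverse[OF inv] unfolding invertible_def by blast
  moreover have "act (matrix_inv A) ` twisted_cubic = twisted_cubic"
  proof -
    have "(\<lambda>S. act (matrix_inv A) (act A S)) ` twisted_cubic = twisted_cubic"
      by (simp only: act_matrix_inv(1)[OF inv] image_ident)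
    then show ?thesis
      unfolding image_image[of "act (matrix_inv A)" "act A", symmetric] cubic_stab_image[OF A] .
  qed
  ultimately show ?thesis by (simp add: cubic_stab_def)
qed

text \<open>S and the points of the cubic are subspaces, so the restriction in
  \<open>projectivities\<close> does not change the images.\<close>

lemma Gq_orbit_eq:
  assumes "vec.subspace S"
  shows "Gq_orbit S = {act A S | A. A \<in> cubic_stab}"
proof -
  have sub: "vec.subspace p" if "p \<in> twisted_cubic" for p :: "('a::field^4) set"
    using that subspace_pg_point by (auto simp: twisted_cubic_def)
  have im: "restrict (act A) {S. vec.subspace S} ` twisted_cubic = act A ` twisted_cubic" for A :: "'a^4^4"
    using sub by (intro image_cong) auto
  show ?thesis
  proof (intro set_eqI iffI)
    fix T assume "T \<in> Gq_orbit S"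
    then obtain g where g: "g \<in> projectivities" "g ` twisted_cubic = twisted_cubic" "T = g S"
      unfolding Gq_orbit_def Gq_def by blast
    then obtain A where A: "invertible A" "g = restrict (act A) {S. vec.subspace S}"
      unfolding projectivities_def by blast
    have "act A ` twisted_cubic = twisted_cubic"
      using g(2) unfolding A(2) im .
    with A(1) have "A \<in> cubic_stab" by (simp add: cubic_stab_def)
    moreover have "T = act A S" unfolding g(3) A(2) using assms by simp
    ultimately show "T \<in> {act A S | A. A \<in> cubic_stab}" by blast
  next
    fix T assume "T \<in> {act A S | A. A \<in> cubic_stab}"
    then obtain A where A: "A \<in> cubic_stab" "T = act A S" by blast
    then have "restrict (act A) {S. vec.subspace S} \<in> projectivities"
      unfolding projectivities_def by (intro CollectI exI[of _ A] conjI refl cubic_stab_invertible)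
    moreover have "restrict (act A) {S. vec.subspace S} ` twisted_cubic = twisted_cubic"
      using cubic_stab_image[OF A(1)] unfolding im .
    ultimately have "restrict (act A) {S. vec.subspace S} \<in> Gq"
      unfolding Gq_def by blast
    moreover have "T = restrict (act A) {S. vec.subspace S} S" using A assms by simp
    ultimately show "T \<in> Gq_orbit S" unfolding Gq_orbit_def by blast
  qed
qed

text \<open>Closure in one direction is enough, since \<open>cubic_stab\<close> contains
  inverses.\<close>

definition stab_invariant :: "('a::field^4) set set \<Rightarrow> bool" where
  "stab_invariant T \<longleftrightarrow> (\<forall>A\<in>cubic_stab. \<forall>S\<in>T. act A S \<in> T)"

lemma stab_invariant_iff:
  assumes "stab_invariant T" "A \<in> cubic_stab"
  shows "act A S \<in> T \<longleftrightarrow> S \<in> T"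
proof
  assume "act A S \<in> T"
  then have "act (matrix_inv A) (act A S) \<in> T"
    using assms matrix_inv_cubic_stab unfolding stab_invariant_def by blast
  then show "S \<in> T" using assms(2) by (simp add: cubic_stab_invertible)
qed (use assms in \<open>auto simp: stab_invariant_def\<close>)

lemma card_supersets_act:
  assumes "stab_invariant T" "A \<in> cubic_stab"
  shows "card {\<pi> \<in> T. act A l \<subseteq> \<pi>} = card {\<pi> \<in> T. l \<subseteq> \<pi>}"
proof (rule bij_betw_same_card[symmetric])
  note inv = cubic_stab_invertible[OF assms(2)]
  have "{\<pi> \<in> T. act A l \<subseteq> \<pi>} = act A ` {\<pi> \<in> T. l \<subseteq> \<pi>}"
  proof (intro equalityI subsetI)
    fix \<pi> assume \<pi>: "\<pi> \<in> {\<pi> \<in> T. act A l \<subseteq> \<pi>}"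
    define \<rho> where "\<rho> = act (matrix_inv A) \<pi>"
    have "\<pi> = act A \<rho>" using inv by (simp add: \<rho>_def)
    with \<pi> show "\<pi> \<in> act A ` {\<pi> \<in> T. l \<subseteq> \<pi>}"
      using stab_invariant_iff[OF assms] act_subset_iff[OF inv] by auto
  qed (use stab_invariant_iff[OF assms] in auto)
  then show "bij_betw (act A) {\<pi> \<in> T. l \<subseteq> \<pi>} {\<pi> \<in> T. act A l \<subseteq> \<pi>}"
    using inj_act[OF inv] by (auto simp: bij_betw_def inj_on_def)
qed

lemma card_subsets_act:
  assumes "stab_invariant T" "A \<in> cubic_stab"
  shows "card {l \<in> T. l \<subseteq> act A \<pi>} = card {l \<in> T. l \<subseteq> \<pi>}"
proof (rule bij_betw_same_card[symmetric])
  note inv = cubic_stab_invertible[OF assms(2)]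
  have "{l \<in> T. l \<subseteq> act A \<pi>} = act A ` {l \<in> T. l \<subseteq> \<pi>}"
  proof (intro equalityI subsetI)
    fix l assume l: "l \<in> {l \<in> T. l \<subseteq> act A \<pi>}"
    define m where "m = act (matrix_inv A) l"
    have "l = act A m" using inv by (simp add: m_def)
    with l show "l \<in> act A ` {l \<in> T. l \<subseteq> \<pi>}"
      using stab_invariant_iff[OF assms] act_subset_iff[OF inv] by auto
  qed (use stab_invariant_iff[OF assms] in auto)
  then show "bij_betw (act A) {l \<in> T. l \<subseteq> \<pi>} {l \<in> T. l \<subseteq> act A \<pi>}"
    using inj_act[OF inv] by (auto simp: bij_betw_def inj_on_def)
qed

lemma stab_invariant_pg_planes: "stab_invariant pg_planes"
  and stab_invariant_twisted_cubic: "stab_invariant twisted_cubic"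
  using cubic_stab_image by (auto simp: stab_invariant_def act_pg_planes cubic_stab_invertible)

lemma stab_invariant_C_planes: "stab_invariant (C_planes d)"
  unfolding stab_invariant_def C_planes_def
  using card_subsets_act[OF stab_invariant_twisted_cubic] stab_invariant_iff[OF stab_invariant_pg_planes]
  by auto

lemma stab_invariant_diff: "stab_invariant S \<Longrightarrow> stab_invariant T \<Longrightarrow> stab_invariant (S - T)"
  unfolding stab_invariant_def[of "S - T"] by (simp add: stab_invariant_iff)

section \<open>Projectivities of the twisted cubic\<close>

text \<open>The linear map on (t^3, t^2, t, 1) induced by t + s, hence the binomial entries;
  \<open>cubic_scale\<close> and \<open>cubic_swap\<close> belong to r t and 1/t in the same
  way.\<close>

definition cubic_shift :: "'a::field \<Rightarrow> 'a^4^4" where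
  "cubic_shift s = vector [vector [1, 3 * s, 3 * s^2, s^3], vector [0, 1, 2 * s, s^2],
    vector [0, 0, 1, s], vector [0, 0, 0, 1]]"

definition cubic_scale :: "'a::field \<Rightarrow> 'a^4^4" where
  "cubic_scale r = vector [vector [r^3, 0, 0, 0], vector [0, r^2, 0, 0],
    vector [0, 0, r, 0], vector [0, 0, 0, 1]]"

definition cubic_swap :: "'a::field^4^4" where
  "cubic_swap = vector [vector [0, 0, 0, 1], vector [0, 0, 1, 0],
    vector [0, 1, 0, 0], vector [1, 0, 0, 0]]"

lemma cubic_shift_mult: "cubic_shift s *v x = vector [x$1 + 3 * s * x$2 + 3 * s^2 * x$3 + s^3 * x$4,
    x$2 + 2 * s * x$3 + s^2 * x$4, x$3 + s * x$4, x$4]"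
  and cubic_scale_mult: "cubic_scale r *v x = vector [r^3 * x$1, r^2 * x$2, r * x$3, x$4]"
  and cubic_swap_mult: "cubic_swap *v x = vector [x$4, x$3, x$2, x$1]"
  by (simp_all add: vec_eq_iff_4 matrix_vector_mult_4 cubic_shift_def cubic_scale_def cubic_swap_def)

lemma invertible_cubic_shift: "invertible (cubic_shift s)"
  and invertible_cubic_scale: "r \<noteq> 0 \<Longrightarrow> invertible (cubic_scale r)"
  and invertible_cubic_swap: "invertible cubic_swap"
  by (rule invertibleI; auto simp: cubic_shift_mult cubic_scale_mult cubic_swap_mult vec_eq_iff_4)+

lemma act_shift_P_inf: "act (cubic_shift s) P_inf = P_inf"
  and act_shift_P_at: "act (cubic_shift s) (P_at t) = P_at (t + s)"
  and act_swap_P_inf: "act cubic_swap P_inf = P_at 0"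
  and act_swap_P_at_0: "act cubic_swap (P_at 0) = P_inf"
  unfolding pg_point_def act_pg_point
  by (simp_all add: cubic_shift_mult cubic_swap_mult power2_eq_square power3_eq_cube algebra_simps)

lemma act_swap_P_at:
  assumes "t \<noteq> 0"
  shows "act cubic_swap (P_at t) = P_at (1 / t)"
proof -
  have "act cubic_swap (P_at t) = pg_point (t^3 * (1 / t)^3) (t^3 * (1 / t)^2) (t^3 * (1 / t)) (t^3 * 1)"
    unfolding pg_point_def act_pg_point
    using assms by (simp add: cubic_swap_mult power2_eq_square power3_eq_cube field_simps)
  also have "\<dots> = P_at (1 / t)"
    using assms by (intro pg_point_scale) simp
  finally show ?thesis .
qed

lemma act_scale_P_inf:
  assumes "r \<noteq> 0"
  shows "act (cubic_scale r) P_inf = P_inf"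
proof -
  have "act (cubic_scale r) P_inf = pg_point (r^3 * 1) (r^3 * 0) (r^3 * 0) (r^3 * 0)"
    unfolding pg_point_def act_pg_point by (simp add: cubic_scale_mult)
  also have "\<dots> = P_inf" using assms by (intro pg_point_scale) simp
  finally show ?thesis .
qed

lemma act_scale_P_at: "act (cubic_scale r) (P_at t) = P_at (r * t)"
  unfolding pg_point_def act_pg_point by (simp add: cubic_scale_mult power_mult_distrib)

lemma twisted_cubic_cases:
  assumes "p \<in> twisted_cubic"
  obtains "p = P_inf" | t where "p = P_at t"
  using assms unfolding twisted_cubic_def by blast

lemma P_inf_in: "P_inf \<in> twisted_cubic" and P_at_in: "P_at t \<in> twisted_cubic"
  unfolding twisted_cubic_def by blast+

lemma cubic_shift_in_stab: "cubic_shift s \<in> (cubic_stab :: ('a::{field,finite}^4^4) set)"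
  by (rule cubic_stabI[OF invertible_cubic_shift], erule twisted_cubic_cases)
    (simp_all only: act_shift_P_inf act_shift_P_at P_inf_in P_at_in)

lemma cubic_scale_in_stab: "r \<noteq> 0 \<Longrightarrow> cubic_scale r \<in> (cubic_stab :: ('a::{field,finite}^4^4) set)"
  by (rule cubic_stabI[OF invertible_cubic_scale], assumption, erule twisted_cubic_cases)
    (simp_all only: not_False_eq_True act_scale_P_inf act_scale_P_at P_inf_in P_at_in)

lemma cubic_swap_in_stab: "cubic_swap \<in> (cubic_stab :: ('a::{field,finite}^4^4) set)"
proof (rule cubic_stabI[OF invertible_cubic_swap])
  fix p :: "('a^4) set" assume "p \<in> twisted_cubic"
  then consider "p = P_inf" | "p = P_at 0" | t where "t \<noteq> 0" "p = P_at t"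
    by (metis twisted_cubic_cases)
  then show "act cubic_swap p \<in> twisted_cubic"
    by cases (simp_all only: not_False_eq_True act_swap_P_inf act_swap_P_at_0 act_swap_P_at P_inf_in P_at_in)
qed

text \<open>The new coefficients are those of f(t - s), where f is the cubic form of the
  plane.\<close>

lemma act_shift_pg_plane:
  assumes "c0 \<noteq> 0 \<or> c1 \<noteq> 0 \<or> c2 \<noteq> 0 \<or> c3 \<noteq> 0"
  shows "act (cubic_shift s) (pg_plane c0 c1 c2 c3)
    = pg_plane c0 (c1 - 3 * s * c0) (c2 - 2 * s * c1 + 3 * s^2 * c0) (c3 - s * c2 + s^2 * c1 - s^3 * c0)"
proof (rule act_pg_plane_eqI[OF invertible_cubic_shift assms])
  show "c0 \<noteq> 0 \<or> c1 - 3 * s * c0 \<noteq> 0 \<or> c2 - 2 * s * c1 + 3 * s^2 * c0 \<noteq> 0 \<or>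
      c3 - s * c2 + s^2 * c1 - s^3 * c0 \<noteq> 0"
    using assms by (cases "c0 = 0"; cases "c1 = 0"; cases "c2 = 0") auto
  fix x assume "x \<in> pg_plane c0 c1 c2 c3"
  then show "cubic_shift s *v x \<in> pg_plane c0 (c1 - 3 * s * c0) (c2 - 2 * s * c1 + 3 * s^2 * c0)
      (c3 - s * c2 + s^2 * c1 - s^3 * c0)"
    by (simp add: cubic_shift_mult power2_eq_square power3_eq_cube algebra_simps)
qed

lemma act_swap_pg_plane:
  assumes "c0 \<noteq> 0 \<or> c1 \<noteq> 0 \<or> c2 \<noteq> 0 \<or> c3 \<noteq> 0"
  shows "act cubic_swap (pg_plane c0 c1 c2 c3) = pg_plane c3 c2 c1 c0"
  using assms by (intro act_pg_plane_eqI[OF invertible_cubic_swap]) (auto simp: cubic_swap_mult algebra_simps)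

lemma act_scale_pg_plane:
  assumes "r \<noteq> 0"
  shows "act (cubic_scale r) (pg_plane 1 0 b c) = pg_plane 1 0 (b * r^2) (c * r^3)"
proof (intro act_pg_plane_eqI[OF invertible_cubic_scale[OF assms]])
  fix x assume x: "x \<in> pg_plane 1 0 b c"
  have "r^3 * x$1 + b * r^2 * (r * x$3) + c * r^3 * x$4 = r^3 * (x$1 + b * x$3 + c * x$4)"
    by (simp add: power2_eq_square power3_eq_cube algebra_simps)
  with x show "cubic_scale r *v x \<in> pg_plane 1 0 (b * r^2) (c * r^3)"
    by (simp add: cubic_scale_mult)
qed auto

lemma act_scale_Gamma_inf:
  assumes "r \<noteq> 0"
  shows "act (cubic_scale r) Gamma_inf = Gamma_inf"
  by (intro act_pg_plane_eqI[OF invertible_cubic_scale[OF assms]]) (auto simp: cubic_scale_mult)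

lemma act_shift_Gamma_inf: "act (cubic_shift s) Gamma_inf = Gamma_inf"
  by (simp add: act_shift_pg_plane)

lemma act_shift_Gamma_at: "act (cubic_shift s) (Gamma_at t) = Gamma_at (t + s)"
proof -
  have "- 3 * t - 3 * s * 1 = - 3 * (t + s)" "3 * t^2 - 2 * s * (- 3 * t) + 3 * s^2 * 1 = 3 * (t + s)^2"
    "- (t^3) - s * (3 * t^2) + s^2 * (- 3 * t) - s^3 * 1 = - ((t + s)^3)"
    by (simp_all add: power2_eq_square power3_eq_cube algebra_simps)
  then show ?thesis by (simp only: act_shift_pg_plane zero_neq_one[symmetric] not_False_eq_True simp_thms)
qed

lemma act_swap_Gamma_inf: "act cubic_swap Gamma_inf = Gamma_at 0"
  by (simp add: act_swap_pg_plane)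

lemma act_swap_Gamma_at_0: "act cubic_swap (Gamma_at 0) = Gamma_inf"
  by (simp add: act_swap_pg_plane)

lemma act_swap_Gamma_at:
  assumes "t \<noteq> 0"
  shows "act cubic_swap (Gamma_at t) = Gamma_at (1 / t)"
proof -
  have "act cubic_swap (Gamma_at t) = pg_plane (- (t^3) * 1) (- (t^3) * (- 3 * (1 / t)))
      (- (t^3) * (3 * (1 / t)^2)) (- (t^3) * (- ((1 / t)^3)))"
    using assms by (simp add: act_swap_pg_plane power2_eq_square power3_eq_cube field_simps)
  also have "\<dots> = Gamma_at (1 / t)" using assms by (intro pg_plane_scale) simp
  finally show ?thesis .
qed

lemma act_scale_Gamma_at:
  assumes "r \<noteq> 0"
  shows "act (cubic_scale r) (Gamma_at t) = Gamma_at (r * t)"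
proof (intro act_pg_plane_eqI[OF invertible_cubic_scale[OF assms]])
  fix x assume x: "x \<in> Gamma_at t"
  have "r^3 * x$1 + (- 3 * (r * t)) * (r^2 * x$2) + (3 * (r * t)^2) * (r * x$3) + (- ((r * t)^3)) * x$4
    = r^3 * (1 * x$1 + (- 3 * t) * x$2 + (3 * t^2) * x$3 + (- (t^3)) * x$4)"
    by (simp add: power2_eq_square power3_eq_cube algebra_simps)
  also have "\<dots> = 0" using x unfolding mem_pg_plane by simp
  finally show "cubic_scale r *v x \<in> Gamma_at (r * t)"
    by (simp add: cubic_scale_mult)
qed auto

lemma Gamma_planes_cases:
  assumes "\<gamma> \<in> Gamma_planes"
  obtains "\<gamma> = Gamma_inf" | t where "\<gamma> = Gamma_at t"
  using assms unfolding Gamma_planes_def by blast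

lemma Gamma_inf_in: "Gamma_inf \<in> Gamma_planes" and Gamma_at_in: "Gamma_at t \<in> Gamma_planes"
  unfolding Gamma_planes_def by blast+

lemma act_shift_Gamma: "\<gamma> \<in> Gamma_planes \<Longrightarrow> act (cubic_shift s) \<gamma> \<in> Gamma_planes"
  by (erule Gamma_planes_cases) (simp_all only: act_shift_Gamma_inf act_shift_Gamma_at Gamma_inf_in Gamma_at_in)

lemma act_scale_Gamma: "r \<noteq> 0 \<Longrightarrow> \<gamma> \<in> Gamma_planes \<Longrightarrow> act (cubic_scale r) \<gamma> \<in> Gamma_planes"
  by (erule Gamma_planes_cases) (simp_all only: not_False_eq_True act_scale_Gamma_inf act_scale_Gamma_at Gamma_inf_in Gamma_at_in)

lemma act_swap_Gamma:
  assumes "\<gamma> \<in> Gamma_planes"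
  shows "act cubic_swap \<gamma> \<in> Gamma_planes"
proof -
  from assms consider "\<gamma> = Gamma_inf" | "\<gamma> = Gamma_at 0" | t where "t \<noteq> 0" "\<gamma> = Gamma_at t"
    by (metis Gamma_planes_cases)
  then show ?thesis
    by cases (simp_all only: not_False_eq_True act_swap_Gamma_inf act_swap_Gamma_at_0 act_swap_Gamma_at Gamma_inf_in Gamma_at_in)
qed

lemma Gamma_planes_subset: "Gamma_planes \<subseteq> pg_planes"
  unfolding Gamma_planes_def by (auto intro!: pg_plane_in_pg_planes)

section \<open>The stabilizer of the cubic permutes the osculating planes\<close>

lemma P_inf_image_imp_column:
  assumes "act A P_inf = P_inf"
  shows "A$2$1 = 0" "A$3$1 = 0" "A$4$1 = (0::'a::field)"
proof -
  have "vec.span {A *v vector [1, 0, 0, 0]} = P_inf"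
    using assms unfolding pg_point_def act_pg_point .
  then have "A *v vector [1, 0, 0, 0] \<in> P_inf" using vec.span_base by blast
  then obtain k where "A *v vector [1, 0, 0, 0] = k *s vector [1, 0, 0, 0]"
    unfolding pg_point_def vec.span_singleton by blast
  then show "A$2$1 = 0" "A$3$1 = 0" "A$4$1 = (0::'a::field)"
    by (simp_all add: vec_eq_iff_4 matrix_vector_mult_4)
qed

lemma P_0_image_imp_column:
  assumes "act A (P_at 0) = P_at 0"
  shows "A$1$4 = 0" "A$2$4 = 0" "A$3$4 = (0::'a::field)"
proof -
  have "vec.span {A *v vector [0, 0, 0, 1]} = pg_point 0 0 0 1"
    using assms unfolding pg_point_def act_pg_point by simp
  then have "A *v vector [0, 0, 0, 1] \<in> pg_point 0 0 0 1" using vec.span_base by blast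
  then obtain k where "A *v vector [0, 0, 0, 1] = k *s vector [0, 0, 0, 1]"
    unfolding pg_point_def vec.span_singleton by blast
  then show "A$1$4 = 0" "A$2$4 = 0" "A$3$4 = (0::'a::field)"
    by (simp_all add: vec_eq_iff_4 matrix_vector_mult_4)
qed

lemma twisted_cubic_equations:
  assumes "p \<in> twisted_cubic" "x \<in> p"
  shows "x$1 * x$3 = (x$2)^2" "x$2 * x$4 = (x$3)^2"
  using assms by (auto simp: twisted_cubic_def pg_point_def vec.span_singleton power2_eq_square power3_eq_cube)

lemma cubic_poly_eq_0:
  fixes k0 :: "'a::{field,finite}"
  assumes "5 \<le> CARD('a)" "\<And>t. t \<noteq> 0 \<Longrightarrow> k3 * t^3 + k2 * t^2 + k1 * t + k0 = 0"
  shows "k3 = 0" "k2 = 0" "k1 = 0" "k0 = 0"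
proof -
  let ?p = "[:k0, k1, k2, k3:]"
  have "?p = 0"
  proof (rule ccontr)
    assume "?p \<noteq> 0"
    then have "card {x. poly ?p x = 0} \<le> degree ?p" by (rule card_poly_roots_bound)
    moreover have "degree ?p \<le> 3" by simp
    moreover have "UNIV - {0} \<subseteq> {x. poly ?p x = 0}"
    proof
      fix t :: 'a assume "t \<in> UNIV - {0}"
      then show "t \<in> {x. poly ?p x = 0}"
        using assms(2)[of t] by (simp add: power2_eq_square power3_eq_cube algebra_simps)
    qed
    then have "card (UNIV - {0::'a}) \<le> card {x. poly ?p x = 0}" by (intro card_mono) auto
    moreover have "card (UNIV - {0::'a}) = CARD('a) - 1" by (simp add: card_Diff_subset)
    ultimately show False using assms(1) by linarith
  qed
  then show "k3 = 0" "k2 = 0" "k1 = 0" "k0 = 0" by auto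
qed

text \<open>The two quadrics \<^term>\<open>x$1 * x$3 = (x$2)^2\<close> and \<^term>\<open>x$2 * x$4 = (x$3)^2\<close> pull back along
  the curve to polynomials that become cubics after division by powers of \<^term>\<open>t\<close>. A cubic with
  \<open>q - 1 \<ge> 4\<close> zeros vanishes identically; the undivided sextics would not suffice for \<open>q = 5\<close>.\<close>

lemma stab_fixing_two_points:
  fixes A :: "'a::{field,finite}^4^4"
  assumes q: "5 \<le> CARD('a)" and A: "A \<in> cubic_stab"
    and fix1: "act A P_inf = P_inf" and fix0: "act A (P_at 0) = P_at 0"
  obtains k r where "k \<noteq> 0" "r \<noteq> 0" "\<And>x. A *v x = k *s (cubic_scale r *v x)"
proof -
  note z1 = P_inf_image_imp_column[OF fix1] and z4 = P_0_image_imp_column[OF fix0]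
  note inv = cubic_stab_invertible[OF A]
  have ker: "x = 0" if "A *v x = 0" for x
    using inj_matrix_vector_mult[OF inv] that by (metis injD matrix_vector_mult_0_right)
  have img: "\<exists>x. A *v x = y" for y
    using matrix_inv_inverse(1)[OF inv] by (metis matrix_vector_mul_assoc matrix_vector_mul_lid)
  define a b c d e f g h i j where "a = A$1$1" and "b = A$1$2" and "c = A$1$3" and "d = A$2$2"
    and "e = A$2$3" and "f = A$3$2" and "g = A$3$3" and "h = A$4$2" and "i = A$4$3" and "j = A$4$4"
  note defs = a_def b_def c_def d_def e_def f_def g_def h_def i_def j_def
  have A_mult: "A *v x = vector [a * x$1 + b * x$2 + c * x$3, d * x$2 + e * x$3, f * x$2 + g * x$3,
    h * x$2 + i * x$3 + j * x$4]" for x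
    using z1 z4 by (simp add: vec_eq_iff_4 matrix_vector_mult_4 defs)
  have a: "a \<noteq> 0" using ker[of "vector [1, 0, 0, 0]"] by (auto simp: A_mult vec_eq_iff_4)
  have j: "j \<noteq> 0" using ker[of "vector [0, 0, 0, 1]"] by (auto simp: A_mult vec_eq_iff_4)
  have quad: "(a * t^3 + b * t^2 + c * t) * (f * t^2 + g * t) = (d * t^2 + e * t)^2"
    "(d * t^2 + e * t) * (h * t^2 + i * t + j) = (f * t^2 + g * t)^2" for t
  proof -
    let ?v = "vector [t^3, t^2, t, 1]"
    have "act A (P_at t) \<in> twisted_cubic" using cubic_stab_image[OF A] P_at_in by blast
    moreover have "A *v ?v \<in> act A (P_at t)" unfolding pg_point_def by (intro imageI vec.span_base) simp
    ultimately show "(a * t^3 + b * t^2 + c * t) * (f * t^2 + g * t) = (d * t^2 + e * t)^2"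
      "(d * t^2 + e * t) * (h * t^2 + i * t + j) = (f * t^2 + g * t)^2"
      using twisted_cubic_equations[of "act A (P_at t)" "A *v ?v"] unfolding A_mult by simp_all
  qed
  have 1: "a * f * t^3 + (a * g + b * f - d^2) * t^2 + (b * g + c * f - 2 * d * e) * t + (c * g - e^2) = 0"
    if "t \<noteq> 0" for t
  proof -
    have "t^2 * (a * f * t^3 + (a * g + b * f - d^2) * t^2 + (b * g + c * f - 2 * d * e) * t + (c * g - e^2))
      = (a * t^3 + b * t^2 + c * t) * (f * t^2 + g * t) - (d * t^2 + e * t)^2"
      by (simp add: power2_eq_square power3_eq_cube algebra_simps)
    with quad(1)[of t] that show ?thesis by simp
  qed
  have 3: "(d * h - f^2) * t^3 + (d * i + e * h - 2 * f * g) * t^2 + (d * j + e * i - g^2) * t + e * j = 0"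
    if "t \<noteq> 0" for t
  proof -
    have "t * ((d * h - f^2) * t^3 + (d * i + e * h - 2 * f * g) * t^2 + (d * j + e * i - g^2) * t + e * j)
      = (d * t^2 + e * t) * (h * t^2 + i * t + j) - (f * t^2 + g * t)^2"
      by (simp add: power2_eq_square power3_eq_cube algebra_simps)
    with quad(2)[of t] that show ?thesis by simp
  qed
  note c1 = cubic_poly_eq_0[OF q 1] and c3 = cubic_poly_eq_0[OF q 3]
  have f: "f = 0" using c1(1) a by simp
  have e: "e = 0" using c3(4) j by simp
  have ag: "a * g = d^2" using c1(2) f by simp
  have dj: "d * j = g^2" using c3(3) e by simp
  \<comment> \<open>With f = 0, a vanishing g would make the third coordinate of every image 0,
    against surjectivity.\<close>
  have g: "g \<noteq> 0"
  proof
    assume "g = 0"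
    obtain x where "A *v x = vector [0, 0, 1, 0]" using img by blast
    with \<open>g = 0\<close> f show False by (simp add: A_mult vec_eq_iff_4)
  qed
  then have d: "d \<noteq> 0" using ag a by auto
  have b: "b = 0" using c1(3) f e g by simp
  have c: "c = 0" using c1(4) e g by simp
  have h: "h = 0" using c3(1) f d by simp
  have i: "i = 0" using c3(2) e f d by simp
  \<comment> \<open>The matrix is now diagonal with entries a, d, g, j. The relations a g = d^2 and
    d j = g^2 make them, read from the last, a geometric progression of ratio g / j.\<close>
  have "j * (g / j)^3 = a" "j * (g / j)^2 = d" "j * (g / j) = g"
  proof -
    show dd: "j * (g / j)^2 = d" "j * (g / j) = g"
      using j dj by (simp_all add: field_simps power2_eq_square)
    have "j * (g / j)^3 = d * (g / j)" unfolding dd(1)[symmetric] by (simp add: power2_eq_square power3_eq_cube)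
    also have "d * (g / j) = d * (d / g)" using dj g j by (simp add: field_simps power2_eq_square)
    also have "d * (d / g) = a" using ag g by (simp add: field_simps power2_eq_square)
    finally show "j * (g / j)^3 = a" .
  qed
  then have "A *v x = j *s (cubic_scale (g / j) *v x)" for x
    unfolding A_mult cubic_scale_mult using f e b c h i j by (simp add: vec_eq_iff_4 flip: mult.assoc)
  with j g show thesis by (intro that[of j "g / j"]) auto
qed

lemma act_smult:
  assumes "k \<noteq> 0" "\<And>x. A *v x = k *s (B *v x)" "vec.subspace S"
  shows "act A S = act B S"
proof -
  have "act B S \<subseteq> act A S"
  proof clarify
    fix x assume "x \<in> S"
    then have "(1 / k) *s x \<in> S" using assms(3) by (rule vec.subspace_scale[rotated])
    moreover have "A *v ((1 / k) *s x) = B *v x"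
      unfolding assms(2) using assms(1) by (simp add: vec.linear_scale[OF matrix_vector_mul_linear_gen])
    ultimately show "B *v x \<in> act A S" by force
  qed
  moreover have "act A S \<subseteq> act B S"
  proof clarify
    fix x assume "x \<in> S"
    then have "k *s x \<in> S" using assms(3) by (rule vec.subspace_scale[rotated])
    moreover have "A *v x = B *v (k *s x)"
      unfolding assms(2) by (simp add: vec.linear_scale[OF matrix_vector_mul_linear_gen])
    ultimately show "A *v x \<in> act B S" by force
  qed
  ultimately show ?thesis by blast
qed

text \<open>B is built from the explicit elements, so its effect on \<Gamma>-planes is known before
  invariance under the whole stabilizer is.\<close>

lemma move_to_P_inf:
  assumes "p \<in> (twisted_cubic :: ('a::{field,finite}^4) set set)"
  obtains B where "B \<in> cubic_stab" "act B p = P_inf" "\<And>\<gamma>. \<gamma> \<in> Gamma_planes \<Longrightarrow> act B \<gamma> \<in> Gamma_planes"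
proof (cases "p = P_inf")
  case True
  then show thesis
    using that[of "cubic_shift 0"] cubic_shift_in_stab act_shift_P_inf act_shift_Gamma by blast
next
  case False
  then obtain t where p: "p = P_at t" using assms by (metis twisted_cubic_cases)
  show thesis
  proof (rule that[of "cubic_swap ** cubic_shift (-t)"])
    show "act (cubic_swap ** cubic_shift (-t)) p = P_inf"
      unfolding act_mult p act_shift_P_at using act_swap_P_at_0 by simp
  qed (simp_all only: cubic_stab_mult cubic_swap_in_stab cubic_shift_in_stab act_mult act_swap_Gamma act_shift_Gamma)
qed

text \<open>Composed with explicit elements, A fixes \<open>P_inf\<close> and \<open>P_at 0\<close>.
  It is then a scalar multiple of some \<open>cubic_scale r\<close>, which preserves the
  \<Gamma>-planes.\<close>

lemma stab_invariant_Gamma: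
  assumes q: "5 \<le> CARD('a::{field,finite})"
  shows "stab_invariant (Gamma_planes :: ('a^4) set set)"
  unfolding stab_invariant_def
proof (intro ballI)
  fix A :: "'a^4^4" and \<gamma> :: "('a^4) set" assume A: "A \<in> cubic_stab" and \<gamma>: "\<gamma> \<in> Gamma_planes"
  obtain B where B: "B \<in> cubic_stab" "act B (act A P_inf) = P_inf"
    "\<And>\<gamma>. \<gamma> \<in> Gamma_planes \<Longrightarrow> act B \<gamma> \<in> Gamma_planes"
    using move_to_P_inf[of "act A P_inf"] cubic_stab_image[OF A] P_inf_in by blast
  have BA: "B ** A \<in> cubic_stab" using A B cubic_stab_mult by blast
  have "act (B ** A) (P_at 0) \<noteq> act (B ** A) P_inf"
    using inj_act[OF cubic_stab_invertible[OF BA]] P_at_neq_P_inf(1)[of "0::'a"] by metis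
  moreover have "act (B ** A) (P_at 0) \<in> twisted_cubic" using cubic_stab_image[OF BA] P_at_in by blast
  ultimately obtain t where t: "act (B ** A) (P_at 0) = P_at t"
    using B(2) unfolding act_mult by (metis twisted_cubic_cases)
  define C where "C = cubic_shift (-t) ** B"
  have C: "C \<in> cubic_stab" "\<And>\<gamma>. \<gamma> \<in> Gamma_planes \<Longrightarrow> act C \<gamma> \<in> Gamma_planes"
    unfolding C_def act_mult using B(1,3) cubic_stab_mult cubic_shift_in_stab act_shift_Gamma by blast+
  have CA: "C ** A \<in> cubic_stab" using C A cubic_stab_mult by blast
  have "act (C ** A) P_inf = P_inf" unfolding C_def act_mult B(2) act_shift_P_inf ..
  moreover have "act (C ** A) (P_at 0) = P_at 0"
    using t act_shift_P_at[of "-t" t] unfolding C_def act_mult by simp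
  ultimately obtain k r where k: "k \<noteq> 0" "r \<noteq> 0" "\<And>x. (C ** A) *v x = k *s (cubic_scale r *v x)"
    using stab_fixing_two_points[OF q CA] by blast
  have "vec.subspace \<gamma>" using \<gamma> Gamma_planes_subset by (auto simp: pg_planes_def)
  then have "act (C ** A) \<gamma> = act (cubic_scale r) \<gamma>" using k by (intro act_smult)
  then have "act C (act A \<gamma>) \<in> Gamma_planes" using act_scale_Gamma[OF k(2) \<gamma>] by (simp only: act_mult)
  \<comment> \<open>C maps the finite set of \<Gamma>-planes injectively into itself, hence onto, so
    it can be cancelled.\<close>
  moreover have "act C ` Gamma_planes = Gamma_planes"
    using C(2) inj_act[OF cubic_stab_invertible[OF C(1)]] by (intro endo_inj_surj inj_onI image_subsetI) simp_all
  ultimately show "act A \<gamma> \<in> Gamma_planes"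
    using inj_act[OF cubic_stab_invertible[OF C(1)]] by (metis imageE)
qed

section \<open>Lines in osculating planes\<close>

lemma act_Int: "invertible A \<Longrightarrow> act A (S \<inter> T) = act A S \<inter> act A T"
  by (rule image_Int[OF inj_matrix_vector_mult])

lemma stab_invariant_real_axes:
  assumes "stab_invariant (Gamma_planes :: ('a::field^4) set set)"
  shows "stab_invariant (real_axes :: ('a^4) set set)"
  unfolding stab_invariant_def
proof (intro ballI)
  fix A :: "'a^4^4" and l :: "('a^4) set" assume A: "A \<in> cubic_stab" and "l \<in> real_axes"
  then obtain \<gamma> \<gamma>' where "l = \<gamma> \<inter> \<gamma>'" "\<gamma> \<in> Gamma_planes" "\<gamma>' \<in> Gamma_planes" "\<gamma> \<noteq> \<gamma>'"
    unfolding real_axes_def by blast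
  moreover note inv = cubic_stab_invertible[OF A]
  ultimately have "act A l = act A \<gamma> \<inter> act A \<gamma>'" "act A \<gamma> \<in> Gamma_planes" "act A \<gamma>' \<in> Gamma_planes"
    "act A \<gamma> \<noteq> act A \<gamma>'"
    using stab_invariant_iff[OF assms A] by (simp_all add: act_Int inj_act)
  then show "act A l \<in> real_axes" unfolding real_axes_def by blast
qed

lemma stab_invariant_EGamma_lines:
  assumes \<Gamma>: "stab_invariant (Gamma_planes :: ('a::field^4) set set)"
  shows "stab_invariant (EGamma_lines :: ('a^4) set set)"
  unfolding stab_invariant_def
proof (intro ballI)
  fix A :: "'a^4^4" and l :: "('a^4) set" assume A: "A \<in> cubic_stab" and l: "l \<in> EGamma_lines"
  note inv = cubic_stab_invertible[OF A]
  have "\<not> p \<subseteq> act A l" if p: "p \<in> twisted_cubic" for p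
  proof -
    obtain p' where "p = act A p'" "p' \<in> twisted_cubic" using p cubic_stab_image[OF A] by blast
    then show ?thesis using l act_subset_iff[OF inv, of p' l] unfolding EGamma_lines_def by blast
  qed
  moreover obtain \<gamma> where "\<gamma> \<in> Gamma_planes" "l \<subseteq> \<gamma>" using l unfolding EGamma_lines_def by blast
  then have "\<exists>\<gamma>\<in>Gamma_planes. act A l \<subseteq> \<gamma>"
    using \<Gamma> A unfolding stab_invariant_def by (meson image_mono)
  moreover have "act A l \<in> pg_lines" using l by (simp add: EGamma_lines_def act_pg_lines[OF inv])
  moreover have "act A l \<notin> real_axes"
    using l stab_invariant_iff[OF stab_invariant_real_axes[OF \<Gamma>] A] by (simp add: EGamma_lines_def)
  ultimately show "act A l \<in> EGamma_lines" by (simp add: EGamma_lines_def)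
qed

text \<open>Only the indices \<^term>\<open>1::int\<close> and \<^term>\<open>-1::int\<close> matter: the index is the quadratic character of
  \<open>-3 b\<close>. Characterizing the class by its \<open>2\<close>-planes makes its invariance immediate.\<close>

definition EGamma_class :: "int \<Rightarrow> ('a::field^4) set set" where
  "EGamma_class i = {l \<in> EGamma_lines. (\<exists>\<pi>\<in>C_planes 2. l \<subseteq> \<pi>) \<longleftrightarrow> i = 1}"

lemma stab_invariant_EGamma_class:
  assumes \<Gamma>: "stab_invariant (Gamma_planes :: ('a::{field,finite}^4) set set)"
  shows "stab_invariant (EGamma_class i :: ('a^4) set set)"
  unfolding stab_invariant_def
proof (intro ballI)
  fix A :: "'a^4^4" and l :: "('a^4) set" assume A: "A \<in> cubic_stab" and l: "l \<in> EGamma_class i"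
  have iff: "(\<exists>\<pi>\<in>C_planes 2. m \<subseteq> \<pi>) \<longleftrightarrow> card {\<pi> \<in> C_planes 2. m \<subseteq> \<pi>} \<noteq> 0" for m :: "('a^4) set"
    by (auto simp: card_eq_0_iff)
  have "act A l \<in> EGamma_class i \<longleftrightarrow> l \<in> EGamma_class i"
    unfolding EGamma_class_def mem_Collect_eq iff card_supersets_act[OF stab_invariant_C_planes A]
      stab_invariant_iff[OF stab_invariant_EGamma_lines[OF \<Gamma>] A] ..
  with l show "act A l \<in> EGamma_class i" by blast
qed

text \<open>Two \<Gamma>-planes through the line would make it a real axis. This allows lines to be
  counted by \<Gamma>-planes without repetition.\<close>

lemma EGamma_line_unique_plane:
  assumes "l \<in> EGamma_lines" "\<gamma> \<in> Gamma_planes" "\<gamma>' \<in> Gamma_planes" "l \<subseteq> \<gamma>" "l \<subseteq> \<gamma>'"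
  shows "\<gamma> = \<gamma>'"
proof (rule ccontr)
  assume "\<gamma> \<noteq> \<gamma>'"
  with assms have "l = \<gamma> \<inter> \<gamma>'"
    using Gamma_planes_subset by (intro pg_line_eq_Int) (auto simp: EGamma_lines_def)
  with assms \<open>\<gamma> \<noteq> \<gamma>'\<close> have "l \<in> real_axes" unfolding real_axes_def by blast
  with assms(1) show False by (simp add: EGamma_lines_def)
qed

lemma Gamma_inf_Int_cong: "Gamma_inf \<inter> pg_plane c0 c1 c2 c3 = Gamma_inf \<inter> pg_plane c0 c1 c2 d"
  by auto

lemma pg_line_in_other_plane:
  assumes l: "l \<in> pg_lines" and v: "v \<notin> l"
  obtains \<pi> where "\<pi> \<in> pg_planes" "l \<subseteq> \<pi>" "v \<in> (\<pi> :: ('a::field^4) set)"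
proof
  let ?S = "{x + y |x y. x \<in> l \<and> y \<in> vec.span {v}}"
  have s: "vec.subspace l" and d: "vec.dim l = 2" using l by (auto simp: pg_lines_def)
  have "l \<inter> vec.span {v} = {0}"
  proof -
    have "k = 0" if "k *s v \<in> l" for k
    proof (rule ccontr)
      assume "k \<noteq> 0"
      then have "v = (1 / k) *s (k *s v)" by simp
      then show False using vec.subspace_scale[OF s that, of "1 / k"] v by simp
    qed
    then show ?thesis using vec.subspace_0[OF s] by (auto simp: vec.span_singleton)
  qed
  moreover have "v \<noteq> 0" using v vec.subspace_0[OF s] by auto
  ultimately have "vec.dim ?S = 3"
    using vec.dim_sums_Int[OF s vec.subspace_span[of "{v}"]] d by simp
  then show "?S \<in> pg_planes"
    using vec.subspace_sums[OF s vec.subspace_span[of "{v}"]] by (simp add: pg_planes_def)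
  show "l \<subseteq> ?S" using vec.span_zero by force
  show "v \<in> ?S" using vec.subspace_0[OF s] vec.span_base[of v "{v}"] by force
qed

locale twisted_cubic_field = cubic_field F for F :: "'a::{field,finite} itself" +
  assumes q5: "5 \<le> CARD('a)"
begin

lemmas Gamma_inv = stab_invariant_Gamma[OF q5]
lemmas class_inv = stab_invariant_EGamma_class[OF Gamma_inv]

lemma Gamma_at_inject: "Gamma_at s = Gamma_at t \<longleftrightarrow> s = (t::'a)"
proof
  assume "Gamma_at s = Gamma_at t"
  from pg_plane_eq_imp_proportional(1)[OF this] have "3 * t = 3 * s" by simp
  then show "s = t" using three by (simp only: mult_cancel_left) simp
qed simp

lemma Gamma_at_neq_inf: "Gamma_at s \<noteq> (Gamma_inf :: ('a^4) set)"
  using pg_plane_eq_imp_proportional(3)[of 1 "- 3 * s" "3 * s^2" "- (s^3)" 0 0 0 1] by auto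

lemma card_Gamma_planes: "card (Gamma_planes :: ('a^4) set set) = CARD('a) + 1"
proof -
  have "card (range (Gamma_at :: 'a \<Rightarrow> _)) = CARD('a)"
    by (intro card_image) (simp only: inj_def Gamma_at_inject simp_thms)
  moreover have "Gamma_inf \<notin> range (Gamma_at :: 'a \<Rightarrow> _)" using Gamma_at_neq_inf by blast
  ultimately show ?thesis unfolding Gamma_planes_def by simp
qed

lemma Gamma_inf_C_planes: "(Gamma_inf :: ('a^4) set) \<in> C_planes 1"
  using pg_plane_in_pg_planes[of 0 0 0 "1::'a"] by (simp add: C_planes_def card_C_points_in_plane)

lemma move_to_Gamma_inf:
  assumes "\<gamma> \<in> (Gamma_planes :: ('a^4) set set)"
  obtains A where "A \<in> cubic_stab" "act A \<gamma> = Gamma_inf"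
  using assms
proof (cases rule: Gamma_planes_cases)
  case 1
  then show thesis using that[OF cubic_shift_in_stab] act_shift_Gamma_inf by blast
next
  case (2 t)
  have "act (cubic_swap ** cubic_shift (-t)) \<gamma> = Gamma_inf"
    unfolding act_mult 2 act_shift_Gamma_at right_minus act_swap_Gamma_at_0 ..
  then show thesis using that cubic_stab_mult cubic_swap_in_stab cubic_shift_in_stab by blast
qed

lemma Gamma_planes_subset_C_planes: "Gamma_planes \<subseteq> (C_planes 1 :: ('a^4) set set)"
proof
  fix \<gamma> :: "('a^4) set" assume "\<gamma> \<in> Gamma_planes"
  then obtain A where A: "A \<in> cubic_stab" "act A \<gamma> = Gamma_inf" by (rule move_to_Gamma_inf)
  then show "\<gamma> \<in> C_planes 1"
    using Gamma_inf_C_planes stab_invariant_iff[OF stab_invariant_C_planes A(1)] by metis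
qed

section \<open>Planes and pencils in depressed form\<close>

lemma depressed_in_pg_planes: "pg_plane 1 0 b c \<in> (pg_planes :: ('a^4) set set)"
  by (rule pg_plane_in_pg_planes) simp

lemma depressed_in_C_planes_iff: "pg_plane 1 0 b c \<in> C_planes d \<longleftrightarrow> card (cubic_roots b (c::'a)) = d"
  using depressed_in_pg_planes by (simp add: C_planes_def card_C_points_in_plane cubic_roots_def)

lemma depressed_in_Gamma_planes_iff: "pg_plane 1 0 b c \<in> Gamma_planes \<longleftrightarrow> b = 0 \<and> (c::'a) = 0"
proof
  assume "pg_plane 1 0 b c \<in> Gamma_planes"
  then show "b = 0 \<and> c = 0"
  proof (cases rule: Gamma_planes_cases)
    case 1
    from pg_plane_eq_imp_proportional(3)[OF this] show ?thesis by simp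
  next
    case (2 t)
    from pg_plane_eq_imp_proportional(1-3)[OF this] show ?thesis by simp
  qed
next
  assume "b = 0 \<and> c = 0"
  then show "pg_plane 1 0 b c \<in> Gamma_planes" using Gamma_at_in[of 0] by simp
qed

lemma depressed_inject: "pg_plane 1 0 b c = pg_plane 1 0 b' c' \<longleftrightarrow> b = b' \<and> c = (c'::'a)"
  using pg_plane_eq_imp_proportional(2,3)[of 1 0 b c 1 0 b' c'] by auto

text \<open>After division by c0, the shift by c1/(3 c0) removes the quadratic term. The constant
  term stays anonymous because the class of a pencil depends on the linear coefficient
  alone.\<close>

lemma depress_leading_coeff_nonzero:
  assumes "c0 \<noteq> (0::'a)"
  obtains c where "act (cubic_shift (c1 / (3 * c0))) (pg_plane c0 c1 c2 c3)
    = pg_plane 1 0 (c2 / c0 - c1^2 / (3 * c0^2)) c"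
proof -
  have "pg_plane c0 c1 c2 c3 = pg_plane (c0 * 1) (c0 * (c1 / c0)) (c0 * (c2 / c0)) (c0 * (c3 / c0))"
    using assms by simp
  also have "\<dots> = pg_plane 1 (c1 / c0) (c2 / c0) (c3 / c0)" using assms by (rule pg_plane_scale)
  finally have 1: "pg_plane c0 c1 c2 c3 = pg_plane 1 (c1 / c0) (c2 / c0) (c3 / c0)" .
  have "c1 / c0 - 3 * (c1 / (3 * c0)) * 1 = 0" using assms by simp
  moreover have "c2 / c0 - 2 * (c1 / (3 * c0)) * (c1 / c0) + 3 * (c1 / (3 * c0))^2 * 1
      = c2 / c0 - c1^2 / (3 * c0^2)"
    using assms by (simp add: field_simps power2_eq_square)
  ultimately show thesis
    using that[of "c3 / c0 - c1 / (3 * c0) * (c2 / c0) + (c1 / (3 * c0))^2 * (c1 / c0) - (c1 / (3 * c0))^3 * 1"]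
      act_shift_pg_plane[of 1 "c1 / c0" "c2 / c0" "c3 / c0" "c1 / (3 * c0)"]
    unfolding 1 by (metis zero_neq_one)
qed

text \<open>The leading coefficient may be 0, so a parameter t that is not a root is first moved to
  infinity; the value of the form at t then becomes the leading coefficient.\<close>

lemma depress_pg_plane:
  assumes "\<pi> \<in> (pg_planes :: ('a^4) set set)"
  obtains A b c where "A \<in> cubic_stab" "act A \<pi> = pg_plane 1 0 b c"
proof -
  obtain c0 c1 c2 c3 where \<pi>: "\<pi> = pg_plane c0 c1 c2 c3" and nz: "c0 \<noteq> 0 \<or> c1 \<noteq> 0 \<or> c2 \<noteq> 0 \<or> c3 \<noteq> 0"
    using assms by (rule pg_planes_cases)
  \<comment> \<open>A nonzero polynomial of degree at most 3 cannot vanish at all of the at least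
    five parameters.\<close>
  have "\<exists>t. c0 * t^3 + c1 * t^2 + c2 * t + c3 \<noteq> 0"
  proof (rule ccontr)
    assume "\<not> ?thesis"
    then have "c0 * t^3 + c1 * t^2 + c2 * t + c3 = 0" for t by simp
    from cubic_poly_eq_0[OF q5 this] nz show False by simp
  qed
  then obtain t where t: "c0 * t^3 + c1 * t^2 + c2 * t + c3 \<noteq> 0" ..
  let ?A = "cubic_swap ** cubic_shift (-t)"
  define f d1 d2 where "f = c0 * t^3 + c1 * t^2 + c2 * t + c3"
    and "d1 = c2 - 2 * (-t) * c1 + 3 * (-t)^2 * c0" and "d2 = c1 - 3 * (-t) * c0"
  have f: "f \<noteq> 0" using t by (simp add: f_def)
  have "c3 - (-t) * c2 + (-t)^2 * c1 - (-t)^3 * c0 = f"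
    by (simp add: f_def algebra_simps)
  then have "act (cubic_shift (-t)) \<pi> = pg_plane c0 d2 d1 f"
    unfolding \<pi> act_shift_pg_plane[OF nz] d1_def d2_def by (simp only:)
  moreover have "act cubic_swap (pg_plane c0 d2 d1 f) = pg_plane f d1 d2 c0"
    using f by (intro act_swap_pg_plane) blast
  ultimately have A: "act ?A \<pi> = pg_plane f d1 d2 c0" by (simp only: act_mult)
  obtain c where c: "act (cubic_shift (d1 / (3 * f))) (pg_plane f d1 d2 c0)
      = pg_plane 1 0 (d2 / f - d1^2 / (3 * f^2)) c"
    using f by (rule depress_leading_coeff_nonzero)
  show thesis
  proof (rule that)
    show "cubic_shift (d1 / (3 * f)) ** ?A \<in> cubic_stab"
      by (intro cubic_stab_mult cubic_shift_in_stab cubic_swap_in_stab)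
    show "act (cubic_shift (d1 / (3 * f)) ** ?A) \<pi> = pg_plane 1 0 (d2 / f - d1^2 / (3 * f^2)) c"
      unfolding act_mult[of "cubic_shift _"] A by (rule c)
  qed
qed

lemma pencil_in_pg_lines:
  assumes "c0 \<noteq> (0::'a)"
  shows "Gamma_inf \<inter> pg_plane c0 c1 c2 c3 \<in> pg_lines"
proof (rule pg_planes_Int_in_pg_lines)
  show "Gamma_inf \<noteq> pg_plane c0 c1 c2 c3"
    using pg_plane_eq_imp_proportional(3)[of 0 0 0 1 c0 c1 c2 c3] assms by auto
qed (use assms in \<open>auto intro: pg_plane_in_pg_planes\<close>)

lemma depressed_pencil_real_axis_iff:
  "Gamma_inf \<inter> pg_plane 1 0 b c \<in> real_axes \<longleftrightarrow> b = (0::'a)"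
proof
  assume "Gamma_inf \<inter> pg_plane 1 0 b c \<in> real_axes"
  then obtain \<gamma> where \<gamma>: "\<gamma> \<in> Gamma_planes" "\<gamma> \<noteq> Gamma_inf" "Gamma_inf \<inter> pg_plane 1 0 b c \<subseteq> \<gamma>"
    unfolding real_axes_def by blast
  then obtain t where t: "\<gamma> = Gamma_at t" using Gamma_planes_cases by metis
  \<comment> \<open>These two vectors span the line; the first forces t = 0 and the second then b =
    0.\<close>
  have "vector [0, 1, 0, 0] \<in> Gamma_at t" "vector [-b, 0, 1, 0] \<in> Gamma_at t"
    using subsetD[OF \<gamma>(3), of "vector [0, 1, 0, 0]"] subsetD[OF \<gamma>(3), of "vector [-b, 0, 1, 0]"]
    unfolding t by simp_all
  then show "b = 0" by simp
next
  assume "b = 0"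
  then have "Gamma_inf \<inter> pg_plane 1 0 b c = Gamma_inf \<inter> Gamma_at 0" by auto
  then show "Gamma_inf \<inter> pg_plane 1 0 b c \<in> real_axes"
    using Gamma_inf_in Gamma_at_in[of "0::'a"] Gamma_at_neq_inf[of 0] unfolding real_axes_def by blast
qed

lemma depressed_pencil_EGamma_iff: "Gamma_inf \<inter> pg_plane 1 0 b c \<in> EGamma_lines \<longleftrightarrow> b \<noteq> (0::'a)"
proof -
  have "\<not> p \<subseteq> Gamma_inf \<inter> pg_plane 1 0 b c" if "p \<in> twisted_cubic" for p
    using that
  proof (cases rule: twisted_cubic_cases)
    case 1
    show ?thesis unfolding 1 by simp
  next
    case (2 t)
    show ?thesis unfolding 2 by simp
  qed
  moreover have "Gamma_inf \<inter> pg_plane 1 0 b c \<in> pg_lines" by (rule pencil_in_pg_lines) simp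
  moreover have "\<exists>\<gamma>\<in>Gamma_planes. Gamma_inf \<inter> pg_plane 1 0 b c \<subseteq> \<gamma>"
    by (rule bexI[OF Int_lower1 Gamma_inf_in])
  ultimately show ?thesis
    unfolding EGamma_lines_def mem_Collect_eq depressed_pencil_real_axis_iff by blast
qed

lemma planes_through_depressed_pencil:
  "{\<pi> \<in> pg_planes. Gamma_inf \<inter> pg_plane 1 0 b c \<subseteq> \<pi>} = insert Gamma_inf (range (pg_plane 1 0 (b::'a)))"
proof (intro equalityI subsetI)
  fix \<pi> assume "\<pi> \<in> {\<pi> \<in> pg_planes. Gamma_inf \<inter> pg_plane 1 0 b c \<subseteq> \<pi>}"
  then have \<pi>: "\<pi> \<in> pg_planes" "Gamma_inf \<inter> pg_plane 1 0 b c \<subseteq> \<pi>" by auto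
  obtain c0 c1 c2 c3 where c: "\<pi> = pg_plane c0 c1 c2 c3" "c0 \<noteq> 0 \<or> c1 \<noteq> 0 \<or> c2 \<noteq> 0 \<or> c3 \<noteq> 0"
    using \<pi>(1) by (rule pg_planes_cases)
  have "vector [0, 1, 0, 0] \<in> \<pi>" "vector [-b, 0, 1, 0] \<in> \<pi>"
    using \<pi>(2) by auto
  then have e: "c1 = 0" "c2 = c0 * b" unfolding c(1) by simp_all
  show "\<pi> \<in> insert Gamma_inf (range (pg_plane 1 0 b))"
  proof (cases "c0 = 0")
    case True
    with c e have "c3 \<noteq> 0" by simp
    with True e have "\<pi> = Gamma_inf" unfolding c(1) by auto
    then show ?thesis by simp
  next
    case False
    then have "\<pi> = pg_plane (c0 * 1) (c0 * 0) (c0 * b) (c0 * (c3 / c0))" unfolding c(1) e by simp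
    also have "\<dots> = pg_plane 1 0 b (c3 / c0)" using False by (rule pg_plane_scale)
    finally show ?thesis by blast
  qed
next
  fix \<pi> assume "\<pi> \<in> insert Gamma_inf (range (pg_plane 1 0 b))"
  then consider "\<pi> = Gamma_inf" | d where "\<pi> = pg_plane 1 0 b d" by blast
  then show "\<pi> \<in> {\<pi> \<in> pg_planes. Gamma_inf \<inter> pg_plane 1 0 b c \<subseteq> \<pi>}"
  proof cases
    case 1
    then show ?thesis using Gamma_inf_in Gamma_planes_subset by blast
  next
    case 2
    then show ?thesis using depressed_in_pg_planes by auto
  qed
qed

lemma card_planes_through_depressed_pencil:
  assumes "T \<subseteq> pg_planes" "Gamma_inf \<notin> T"
  shows "card {\<pi> \<in> T. Gamma_inf \<inter> pg_plane 1 0 b c \<subseteq> \<pi>} = card {d. pg_plane 1 0 (b::'a) d \<in> T}"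
proof -
  have "{\<pi> \<in> T. Gamma_inf \<inter> pg_plane 1 0 b c \<subseteq> \<pi>} = {\<pi> \<in> pg_planes. Gamma_inf \<inter> pg_plane 1 0 b c \<subseteq> \<pi>} \<inter> T"
    using assms(1) by blast
  also have "\<dots> = pg_plane 1 0 b ` {d. pg_plane 1 0 b d \<in> T}"
    unfolding planes_through_depressed_pencil using assms(2) by blast
  finally show ?thesis
    by (simp only:) (intro card_image inj_onI, simp add: depressed_inject)
qed

lemma Gamma_inf_notin_C_planes: "d \<noteq> 1 \<Longrightarrow> (Gamma_inf :: ('a^4) set) \<notin> C_planes d"
  using Gamma_inf_C_planes by (simp add: C_planes_def)

lemma C_planes_subset: "C_planes d \<subseteq> pg_planes"
  by (auto simp: C_planes_def)

text \<open>There are \<open>1 + qchar (-3 * b)\<close> planes with two points through the line, so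
  one exists unless the character is -1. For b = 0 the line is a real axis.\<close>

lemma depressed_pencil_class_iff:
  assumes i: "i \<in> {1, -1}"
  shows "Gamma_inf \<inter> pg_plane 1 0 b c \<in> EGamma_class i \<longleftrightarrow> qchar (-3 * b) = (i::int) \<and> b \<noteq> (0::'a)"
proof (cases "b = 0")
  case False
  let ?l = "Gamma_inf \<inter> pg_plane 1 0 b c"
  have "(\<exists>\<pi>\<in>C_planes 2. ?l \<subseteq> \<pi>) \<longleftrightarrow> card {\<pi> \<in> C_planes 2. ?l \<subseteq> \<pi>} \<noteq> 0"
    by (auto simp: card_eq_0_iff)
  also have "card {\<pi> \<in> C_planes 2. ?l \<subseteq> \<pi>} = card {d. pg_plane 1 0 b d \<in> C_planes 2}"
    by (intro card_planes_through_depressed_pencil C_planes_subset Gamma_inf_notin_C_planes) simp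
  also have "\<dots> \<noteq> 0 \<longleftrightarrow> qchar (-3 * b) \<noteq> -1"
    unfolding depressed_in_C_planes_iff using cubic_counts(1)[OF False] by linarith
  also have "\<dots> \<longleftrightarrow> qchar (-3 * b) = 1"
  proof -
    have "-3 * b \<noteq> 0" using False by simp
    then have "qchar (-3 * b) \<noteq> 0" unfolding qchar_eq_0_iff .
    then show ?thesis using qchar_values[of "-3 * b"] by auto
  qed
  finally have iff: "(\<exists>\<pi>\<in>C_planes 2. ?l \<subseteq> \<pi>) \<longleftrightarrow> qchar (-3 * b) = 1" .
  have "-3 * b \<noteq> 0" using False by simp
  then have "qchar (-3 * b) \<noteq> 0" unfolding qchar_eq_0_iff .
  then have "qchar (-3 * b) \<in> {1, -1}" using qchar_values[of "-3 * b"] by blast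
  then show ?thesis
    using i False depressed_pencil_EGamma_iff[of b c] unfolding EGamma_class_def mem_Collect_eq iff by auto
next
  case True
  then show ?thesis using depressed_pencil_EGamma_iff[of b c] unfolding EGamma_class_def by blast
qed

text \<open>For c0 = 0 the line contains \<open>P_inf\<close>. Otherwise depressing yields a linear
  coefficient b with -3 b c0^2 = c1^2 - 3 c0 c2, and the factor c0^2 is a square.\<close>

lemma pencil_class_iff:
  assumes i: "i \<in> {1, -1}"
  shows "Gamma_inf \<inter> pg_plane c0 c1 c2 c3 \<in> EGamma_class i \<longleftrightarrow> c0 \<noteq> 0 \<and> qchar (c1^2 - 3 * c0 * c2 :: 'a) = i"
proof (cases "c0 = 0")
  case True
  then have "P_inf \<subseteq> Gamma_inf \<inter> pg_plane c0 c1 c2 c3" by simp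
  then show ?thesis using True P_inf_in unfolding EGamma_class_def EGamma_lines_def by blast
next
  case False
  let ?b = "c2 / c0 - c1^2 / (3 * c0^2)" and ?s = "c1 / (3 * c0)"
  obtain c where c: "act (cubic_shift ?s) (pg_plane c0 c1 c2 c3) = pg_plane 1 0 ?b c"
    using depress_leading_coeff_nonzero[OF False] .
  have "act (cubic_shift ?s) (Gamma_inf \<inter> pg_plane c0 c1 c2 c3) = Gamma_inf \<inter> pg_plane 1 0 ?b c"
    by (simp only: act_Int invertible_cubic_shift act_shift_Gamma_inf c)
  then have "Gamma_inf \<inter> pg_plane c0 c1 c2 c3 \<in> EGamma_class i \<longleftrightarrow> Gamma_inf \<inter> pg_plane 1 0 ?b c \<in> EGamma_class i"
    using stab_invariant_iff[OF class_inv cubic_shift_in_stab] by metis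
  also have "\<dots> \<longleftrightarrow> qchar (-3 * ?b) = i \<and> ?b \<noteq> 0" by (rule depressed_pencil_class_iff[OF i])
  also have "qchar (-3 * ?b) = qchar (-3 * ?b * c0^2)" by (rule qchar_mult_power2[OF False, symmetric])
  also have "-3 * ?b * c0^2 = c1^2 - 3 * c0 * c2"
    using False by (simp add: field_simps power2_eq_square)
  also have "?b \<noteq> 0 \<longleftrightarrow> c1^2 - 3 * c0 * c2 \<noteq> 0"
  proof -
    have "x \<noteq> 0 \<longleftrightarrow> -3 * x * c0^2 \<noteq> 0" for x using False by simp
    then show ?thesis unfolding \<open>-3 * ?b * c0^2 = _\<close>[symmetric] .
  qed
  finally show ?thesis using False i by auto
qed

lemma EGamma_class_subset: "EGamma_class i \<subseteq> EGamma_lines"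
  by (auto simp: EGamma_class_def)

lemma EGamma_line_in_Gamma_inf:
  assumes l: "l \<in> EGamma_lines" "l \<subseteq> (Gamma_inf :: ('a^4) set)"
  obtains a b where "l = Gamma_inf \<inter> pg_plane 1 a b 0"
proof -
  let ?e = "vector [0, 0, 0, 1] :: 'a^4"
  have line: "l \<in> pg_lines" using l by (simp add: EGamma_lines_def)
  have "?e \<notin> l" using l(2) by auto
  then obtain \<pi> where \<pi>: "\<pi> \<in> pg_planes" "l \<subseteq> \<pi>" "?e \<in> \<pi>" using pg_line_in_other_plane[OF line] by metis
  then have ne: "Gamma_inf \<noteq> \<pi>" by auto
  have eq: "l = Gamma_inf \<inter> \<pi>"
    using line l(2) \<pi>(1,2) ne Gamma_inf_in Gamma_planes_subset by (intro pg_line_eq_Int) auto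
  obtain c0 c1 c2 c3 where c: "\<pi> = pg_plane c0 c1 c2 c3"
    using \<pi>(1) by (rule pg_planes_cases)
  have "\<not> P_inf \<subseteq> l" using l P_inf_in unfolding EGamma_lines_def by blast
  then have "c0 \<noteq> 0" unfolding eq c by simp
  then have "\<pi> = pg_plane (c0 * 1) (c0 * (c1 / c0)) (c0 * (c2 / c0)) (c0 * (c3 / c0))" unfolding c by simp
  also have "\<dots> = pg_plane 1 (c1 / c0) (c2 / c0) (c3 / c0)" using \<open>c0 \<noteq> 0\<close> by (rule pg_plane_scale)
  finally show thesis using that eq Gamma_inf_Int_cong by metis
qed

section \<open>Transitivity on the two classes, and their sizes\<close>

lemma depress_EGamma_line:
  assumes "l \<in> (EGamma_lines :: ('a^4) set set)"
  obtains A b where "A \<in> cubic_stab" "act A l = Gamma_inf \<inter> pg_plane 1 0 b 0"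
proof -
  obtain \<gamma> where \<gamma>: "\<gamma> \<in> Gamma_planes" "l \<subseteq> \<gamma>" using assms unfolding EGamma_lines_def by blast
  obtain A where A: "A \<in> cubic_stab" "act A \<gamma> = Gamma_inf" using \<gamma>(1) by (rule move_to_Gamma_inf)
  have "act A l \<in> EGamma_lines"
    using assms A(1) stab_invariant_EGamma_lines[OF Gamma_inv] unfolding stab_invariant_def by blast
  moreover have "act A l \<subseteq> Gamma_inf" using \<gamma>(2) A(2) image_mono by metis
  ultimately obtain a b where ab: "act A l = Gamma_inf \<inter> pg_plane 1 a b 0" by (rule EGamma_line_in_Gamma_inf)
  obtain s b' c where "act (cubic_shift s) (pg_plane 1 a b 0) = pg_plane 1 0 b' c"
    using depress_leading_coeff_nonzero[of 1 a b 0] by (metis zero_neq_one)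
  then have "act (cubic_shift s ** A) l = Gamma_inf \<inter> pg_plane 1 0 b' 0"
    by (simp only: act_mult ab act_Int invertible_cubic_shift act_shift_Gamma_inf) (rule Gamma_inf_Int_cong)
  moreover have "cubic_shift s ** A \<in> cubic_stab" using A(1) cubic_stab_mult cubic_shift_in_stab by blast
  ultimately show thesis by (rule that[rotated])
qed

text \<open>Normal forms of the same class have coefficients with b'/b = r^2, and scaling by r
  multiplies the linear coefficient by r^2.\<close>

lemma EGamma_class_transitive:
  assumes i: "i \<in> {1, -1}" and l: "l \<in> EGamma_class i" "m \<in> (EGamma_class i :: ('a^4) set set)"
  obtains A where "A \<in> cubic_stab" "m = act A l"
proof -
  obtain A b where A: "A \<in> cubic_stab" "act A l = Gamma_inf \<inter> pg_plane 1 0 b 0"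
    using subsetD[OF EGamma_class_subset l(1)] by (rule depress_EGamma_line)
  obtain B b' where B: "B \<in> cubic_stab" "act B m = Gamma_inf \<inter> pg_plane 1 0 b' 0"
    using subsetD[OF EGamma_class_subset l(2)] by (rule depress_EGamma_line)
  have b: "qchar (-3 * b) = i" "b \<noteq> 0" "qchar (-3 * b') = i" "b' \<noteq> 0"
    using l A B stab_invariant_iff[OF class_inv] depressed_pencil_class_iff[OF i] by metis+
  have "qchar (-3 * b' * (-3 * b)) = 1"
    using b(1,3) i unfolding qchar_mult by auto
  moreover have "-3 * b' * (-3 * b) = b' / b * (3 * b)^2"
    using b by (simp add: power2_eq_square field_simps)
  ultimately have "qchar (b' / b) = 1"
    using b(2) qchar_mult_power2[of "3 * b" "b' / b"] by simp
  then obtain r where "b' / b = r^2" by (auto simp: qchar_def split: if_splits)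
  moreover have "b' / b \<noteq> 0" using b by simp
  ultimately have r: "b' / b = r^2" "r \<noteq> 0" by auto
  then have b': "b' = b * r^2" using b by (simp add: field_simps)
  have "act (cubic_scale r) (act A l) = act B m"
    unfolding A B b' using r(2) by (simp add: act_Int invertible_cubic_scale act_scale_Gamma_inf act_scale_pg_plane)
  then have "m = act (matrix_inv B ** (cubic_scale r ** A)) l"
    unfolding act_mult using act_matrix_inv(1)[OF cubic_stab_invertible[OF B(1)]] by simp
  moreover have "matrix_inv B ** (cubic_scale r ** A) \<in> cubic_stab"
    using A(1) B(1) r(2) by (intro cubic_stab_mult matrix_inv_cubic_stab cubic_scale_in_stab)
  ultimately show thesis by (rule that[rotated])
qed

lemma Gq_orbit_EGamma_class:
  assumes i: "i \<in> {1, -1}" and l: "l \<in> (EGamma_class i :: ('a^4) set set)"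
  shows "Gq_orbit l = EGamma_class i"
proof -
  have "vec.subspace l" using l by (simp add: EGamma_class_def EGamma_lines_def pg_lines_def)
  then have "Gq_orbit l = {act A l | A. A \<in> cubic_stab}" by (rule Gq_orbit_eq)
  also have "\<dots> = EGamma_class i"
  proof (intro equalityI subsetI)
    fix m assume "m \<in> {act A l | A. A \<in> cubic_stab}"
    then obtain A where "A \<in> cubic_stab" "m = act A l" by blast
    then show "m \<in> EGamma_class i" using l stab_invariant_iff[OF class_inv] by simp
  next
    fix m :: "('a^4) set" assume "m \<in> EGamma_class i"
    then obtain A where "A \<in> cubic_stab" "m = act A l" by (rule EGamma_class_transitive[OF i l])
    then show "m \<in> {act A l | A. A \<in> cubic_stab}" by blast
  qed
  finally show ?thesis .
qed

lemma EGamma_lines_eq: "EGamma_lines = EGamma_class 1 \<union> EGamma_class (-1)"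
  by (auto simp: EGamma_class_def)

lemma EGamma_class_nonempty:
  assumes i: "i \<in> {1, -1}"
  shows "EGamma_class i \<noteq> ({} :: ('a^4) set set)"
proof -
  have "2 * int (card {x::'a. qchar x = i}) = int CARD('a) - 1" using card_qchar_pm1 i by auto
  then have "card {x::'a. qchar x = i} \<noteq> 0" using q5 by linarith
  then obtain x :: 'a where x: "qchar x = i" by (metis (mono_tags, lifting) Collect_empty_eq card.empty)
  then have "x \<noteq> 0" using i by auto
  then have "qchar (-3 * (- x / 3)) = i" "- x / 3 \<noteq> 0" using x by simp_all
  then show ?thesis using depressed_pencil_class_iff[OF i] by blast
qed

text \<open>Lines of \<open>Gamma_inf\<close> missing \<open>P_inf\<close> have unique coordinates
  (a, b), and their class is decided by \<open>a^2 - 3 * b\<close>. For each of the q values of a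
  this expression runs once through the field as b does.\<close>

lemma card_EGamma_class_in_Gamma_inf:
  assumes i: "i \<in> {1, -1}"
  shows "2 * card {l \<in> EGamma_class i. l \<subseteq> (Gamma_inf :: ('a^4) set)} = CARD('a) * (CARD('a) - 1)"
proof -
  let ?L = "\<lambda>(a::'a, b). Gamma_inf \<inter> pg_plane 1 a b 0"
  let ?D = "SIGMA a:UNIV. {b::'a. qchar (a^2 - 3 * b) = i}"
  have D: "?L (a, b) \<in> EGamma_class i \<longleftrightarrow> (a, b) \<in> ?D" for a b
    using pencil_class_iff[OF i, of 1 a b 0] by simp
  have "{l \<in> EGamma_class i. l \<subseteq> Gamma_inf} = ?L ` ?D"
  proof (intro equalityI subsetI)
    fix l assume l: "l \<in> {l \<in> EGamma_class i. l \<subseteq> (Gamma_inf :: ('a^4) set)}"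
    then have "l \<in> EGamma_lines" "l \<subseteq> Gamma_inf" using EGamma_class_subset by blast+
    then obtain a b where ab: "l = Gamma_inf \<inter> pg_plane 1 a b 0" by (rule EGamma_line_in_Gamma_inf)
    then have "l = ?L (a, b)" by simp
    moreover from this have "(a, b) \<in> ?D" using l D[of a b] by blast
    ultimately show "l \<in> ?L ` ?D" by (rule image_eqI)
  next
    fix l assume "l \<in> ?L ` ?D"
    then obtain p where p: "p \<in> ?D" "l = ?L p" by (rule imageE)
    obtain a b where ab: "p = (a, b)" by (cases p)
    have "l \<in> EGamma_class i" unfolding p(2) ab D using p(1) unfolding ab .
    moreover have "l \<subseteq> Gamma_inf" unfolding p(2) ab by simp
    ultimately show "l \<in> {l \<in> EGamma_class i. l \<subseteq> (Gamma_inf :: ('a^4) set)}" by blast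
  qed
  moreover have "inj_on ?L ?D"
  proof (rule inj_onI)
    fix p p' :: "'a \<times> 'a" assume "?L p = ?L p'"
    moreover obtain a b a' b' where p: "p = (a, b)" "p' = (a', b')" by (cases p, cases p')
    ultimately have eq: "Gamma_inf \<inter> pg_plane 1 a b 0 = Gamma_inf \<inter> pg_plane 1 a' b' 0" by simp
    \<comment> \<open>Two vectors of the first line; substituted into the second equation they give
      a' = a and b' = b.\<close>
    have "vector [-a, 1, 0, 0] \<in> Gamma_inf \<inter> pg_plane 1 a b 0" "vector [-b, 0, 1, 0] \<in> Gamma_inf \<inter> pg_plane 1 a b 0"
      by simp_all
    then have "vector [-a, 1, 0, 0] \<in> pg_plane 1 a' b' 0" "vector [-b, 0, 1, 0] \<in> pg_plane 1 a' b' 0"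
      unfolding eq by blast+
    then show "p = p'" unfolding p by simp
  qed
  ultimately have "card {l \<in> EGamma_class i. l \<subseteq> (Gamma_inf :: ('a^4) set)} = card ?D"
    by (simp only: card_image)
  also have "card ?D = (\<Sum>a\<in>UNIV. card {b::'a. qchar (a^2 - 3 * b) = i})" by simp
  also have "\<dots> = (\<Sum>a\<in>(UNIV::'a set). card {x::'a. qchar x = i})"
  proof (intro sum.cong refl bij_betw_same_card)
    fix a :: 'a
    have e: "a^2 - 3 * ((a^2 - x) / 3) = x" for x
      using nonzero_mult_div_cancel_left[OF three, of "a^2 - x"] by (simp only: times_divide_eq_right diff_diff_eq2) simp
    show "bij_betw (\<lambda>b. a^2 - 3 * b) {b. qchar (a^2 - 3 * b) = i} {x. qchar x = i}"
    proof (rule bij_betw_byWitness[where f' = "\<lambda>x. (a^2 - x) / 3"])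
      show "\<forall>b\<in>{b. qchar (a^2 - 3 * b) = i}. (a^2 - (a^2 - 3 * b)) / 3 = b" by simp
      show "\<forall>x\<in>{x. qchar x = i}. a^2 - 3 * ((a^2 - x) / 3) = x" unfolding e by simp
      show "(\<lambda>b. a^2 - 3 * b) ` {b. qchar (a^2 - 3 * b) = i} \<subseteq> {x. qchar x = i}" by blast
      show "(\<lambda>x. (a^2 - x) / 3) ` {x. qchar x = i} \<subseteq> {b. qchar (a^2 - 3 * b) = i}"
        unfolding image_subset_iff mem_Collect_eq e by simp
    qed
  qed
  also have "2 * \<dots> = CARD('a) * (2 * card {x::'a. qchar x = i})" by simp
  also have "2 * card {x::'a. qchar x = i} = CARD('a) - 1"
    using card_qchar_pm1 i by (auto simp: of_nat_diff)
  finally show ?thesis .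
qed

text \<open>Each line of the class lies in exactly one of the q + 1 \<Gamma>-planes, and by
  invariance each of these contains as many as \<open>Gamma_inf\<close>.\<close>

lemma card_EGamma_class:
  assumes i: "i \<in> {1, -1}"
  shows "2 * card (EGamma_class i :: ('a^4) set set) = (CARD('a) + 1) * (CARD('a) * (CARD('a) - 1))"
proof -
  let ?C = "\<lambda>\<gamma> :: ('a^4) set. {l \<in> EGamma_class i. l \<subseteq> \<gamma>}"
  have "EGamma_class i = (\<Union>\<gamma>\<in>Gamma_planes. ?C \<gamma>)"
    unfolding EGamma_class_def EGamma_lines_def by blast
  then have "card (EGamma_class i :: ('a^4) set set) = card (\<Union>\<gamma>\<in>Gamma_planes. ?C \<gamma>)" by (rule arg_cong)
  also have "\<dots> = (\<Sum>\<gamma>\<in>Gamma_planes. card (?C \<gamma>))"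
    using EGamma_line_unique_plane EGamma_class_subset[of i] by (intro card_UN_disjoint) (simp, simp, blast)
  also have "\<dots> = (\<Sum>\<gamma>\<in>(Gamma_planes :: ('a^4) set set). card (?C Gamma_inf))"
  proof (rule sum.cong[OF refl])
    fix \<gamma> :: "('a^4) set" assume "\<gamma> \<in> Gamma_planes"
    then obtain A where A: "A \<in> cubic_stab" "act A \<gamma> = Gamma_inf" by (rule move_to_Gamma_inf)
    show "card (?C \<gamma>) = card (?C Gamma_inf)"
      using card_subsets_act[OF class_inv A(1), of i \<gamma>] unfolding A(2) by simp
  qed
  also have "2 * \<dots> = card (Gamma_planes :: ('a^4) set set) * (2 * card (?C Gamma_inf))" by simp
  finally show ?thesis unfolding card_EGamma_class_in_Gamma_inf[OF i] card_Gamma_planes .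
qed

text \<open>Moving s to 0 and swapping sends \<open>Gamma_at s\<close> to \<open>Gamma_inf\<close>
  and f = t^3 + b t + c to the form with coefficients f(s), f'(s), f''(s)/2 = 3 s and 1. The
  criterion at infinity becomes the character of f'(s)^2 - 9 s f(s), the Hessian.\<close>

lemma Gamma_at_Int_class_iff:
  assumes i: "i \<in> {1, -1}"
  shows "Gamma_at s \<inter> pg_plane 1 0 b c \<in> EGamma_class i
    \<longleftrightarrow> s \<notin> cubic_roots b c \<and> qchar (hess b c s) = i"
proof -
  let ?A = "cubic_swap ** cubic_shift (-s)" and ?f = "s^3 + b * s + c"
  have A: "?A \<in> cubic_stab" by (intro cubic_stab_mult cubic_swap_in_stab cubic_shift_in_stab)
  have "act ?A (Gamma_at s) = Gamma_inf"
    unfolding act_mult act_shift_Gamma_at right_minus act_swap_Gamma_at_0 ..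
  moreover have "act ?A (pg_plane 1 0 b c) = pg_plane ?f (3 * s^2 + b) (3 * s) 1"
  proof -
    have "act (cubic_shift (-s)) (pg_plane 1 0 b c) = pg_plane 1 (3 * s) (3 * s^2 + b) ?f"
      by (simp add: act_shift_pg_plane algebra_simps)
    then show ?thesis unfolding act_mult by (simp add: act_swap_pg_plane)
  qed
  ultimately have "act ?A (Gamma_at s \<inter> pg_plane 1 0 b c) = Gamma_inf \<inter> pg_plane ?f (3 * s^2 + b) (3 * s) 1"
    by (simp only: act_Int[OF cubic_stab_invertible[OF A]])
  then have "Gamma_at s \<inter> pg_plane 1 0 b c \<in> EGamma_class i
      \<longleftrightarrow> Gamma_inf \<inter> pg_plane ?f (3 * s^2 + b) (3 * s) 1 \<in> EGamma_class i"
    using stab_invariant_iff[OF class_inv A] by metis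
  also have "\<dots> \<longleftrightarrow> ?f \<noteq> 0 \<and> qchar ((3 * s^2 + b)^2 - 3 * ?f * (3 * s)) = i"
    by (rule pencil_class_iff[OF i])
  also have "(3 * s^2 + b)^2 - 3 * ?f * (3 * s) = hess b c s"
    by (simp add: hess_def power2_eq_square power3_eq_cube algebra_simps)
  finally show ?thesis by (simp add: cubic_roots_def)
qed

text \<open>Each such line is cut out by its unique \<Gamma>-plane, so it suffices to count
  \<Gamma>-planes; \<open>nz\<close> ensures that the given plane is not one of them.\<close>

lemma card_EGamma_class_in_depressed_plane:
  assumes i: "i \<in> {1, -1}" and nz: "b \<noteq> 0 \<or> c \<noteq> (0::'a)"
  shows "int (card {l \<in> EGamma_class i. l \<subseteq> pg_plane 1 0 b c}) = pencil_count i b c"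
proof -
  let ?\<pi> = "pg_plane 1 0 b c" and ?S = "{s. s \<notin> cubic_roots b c \<and> qchar (hess b c s) = i}"
  let ?G = "{\<gamma> \<in> Gamma_planes. \<gamma> \<inter> ?\<pi> \<in> EGamma_class i}"
  have ne: "\<gamma> \<noteq> ?\<pi>" if "\<gamma> \<in> Gamma_planes" for \<gamma>
    using that nz depressed_in_Gamma_planes_iff by blast
  have "bij_betw (\<lambda>\<gamma>. \<gamma> \<inter> ?\<pi>) ?G {l \<in> EGamma_class i. l \<subseteq> ?\<pi>}"
    unfolding bij_betw_def
  proof
    show "inj_on (\<lambda>\<gamma>. \<gamma> \<inter> ?\<pi>) ?G"
    proof (rule inj_onI)
      fix \<gamma> \<gamma>' assume "\<gamma> \<in> ?G" "\<gamma>' \<in> ?G" and eq: "\<gamma> \<inter> ?\<pi> = \<gamma>' \<inter> ?\<pi>"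
      then have "\<gamma> \<inter> ?\<pi> \<in> EGamma_lines" "\<gamma> \<in> Gamma_planes" "\<gamma>' \<in> Gamma_planes"
        using EGamma_class_subset by blast+
      then show "\<gamma> = \<gamma>'" using eq by (intro EGamma_line_unique_plane) blast+
    qed
    show "(\<lambda>\<gamma>. \<gamma> \<inter> ?\<pi>) ` ?G = {l \<in> EGamma_class i. l \<subseteq> ?\<pi>}"
    proof (intro equalityI subsetI)
      fix l assume l: "l \<in> {l \<in> EGamma_class i. l \<subseteq> ?\<pi>}"
      then obtain \<gamma> where \<gamma>: "\<gamma> \<in> Gamma_planes" "l \<subseteq> \<gamma>" "l \<in> pg_lines"
        unfolding EGamma_class_def EGamma_lines_def by blast
      then have "l = \<gamma> \<inter> ?\<pi>"
        using l ne Gamma_planes_subset depressed_in_pg_planes by (intro pg_line_eq_Int) auto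
      then show "l \<in> (\<lambda>\<gamma>. \<gamma> \<inter> ?\<pi>) ` ?G" using l \<gamma>(1) by blast
    qed blast
  qed
  then have "card {l \<in> EGamma_class i. l \<subseteq> ?\<pi>} = card ?G" by (simp add: bij_betw_same_card)
  moreover have "?G = (if qchar (-3 * b) = i then insert Gamma_inf (Gamma_at ` ?S) else Gamma_at ` ?S)"
  proof -
    have inf: "Gamma_inf \<inter> ?\<pi> \<in> EGamma_class i \<longleftrightarrow> qchar (-3 * b) = i"
      using pencil_class_iff[OF i, of 1 0 b c] by simp
    have "{\<gamma> \<in> insert g (range f). Q \<gamma>} = (if Q g then insert g (f ` {t. Q (f t)}) else f ` {t. Q (f t)})"
      for g :: "('a^4) set" and f :: "'a \<Rightarrow> ('a^4) set" and Q
      by auto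
    from this[of Gamma_inf Gamma_at "\<lambda>\<gamma>. \<gamma> \<inter> ?\<pi> \<in> EGamma_class i"] show ?thesis
      unfolding Gamma_planes_def[symmetric] inf Gamma_at_Int_class_iff[OF i] .
  qed
  moreover have "card (Gamma_at ` ?S) = card ?S"
    by (intro card_image inj_onI) (simp only: Gamma_at_inject)
  moreover have "Gamma_inf \<notin> Gamma_at ` ?S" using Gamma_at_neq_inf by blast
  ultimately show ?thesis by (simp add: pencil_count_def)
qed

lemma card_EGamma_class_in_plane:
  assumes i: "i \<in> {1, -1}" and \<pi>: "\<pi> \<in> C_planes d" "\<pi> \<notin> (Gamma_planes :: ('a^4) set set)"
  obtains b c where "b \<noteq> 0 \<or> c \<noteq> 0" "card (cubic_roots b c) = d"
    "int (card {l \<in> EGamma_class i. l \<subseteq> \<pi>}) = pencil_count i b c"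
proof -
  obtain A b c where A: "A \<in> cubic_stab" "act A \<pi> = pg_plane 1 0 b c"
    using subsetD[OF C_planes_subset \<pi>(1)] by (rule depress_pg_plane)
  have nz: "b \<noteq> 0 \<or> c \<noteq> 0"
    using \<pi>(2) A stab_invariant_iff[OF Gamma_inv] depressed_in_Gamma_planes_iff by metis
  have "card (cubic_roots b c) = d"
    using \<pi>(1) A stab_invariant_iff[OF stab_invariant_C_planes] depressed_in_C_planes_iff by metis
  moreover have "int (card {l \<in> EGamma_class i. l \<subseteq> \<pi>}) = pencil_count i b c"
    using card_subsets_act[OF class_inv A(1), of i \<pi>] card_EGamma_class_in_depressed_plane[OF i nz]
    unfolding A(2) by simp
  ultimately show thesis using nz that by blast
qed

lemma card_planes_through_EGamma_class:
  assumes i: "i \<in> {1, -1}" and l: "l \<in> (EGamma_class i :: ('a^4) set set)"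
    and T: "stab_invariant T" "T \<subseteq> pg_planes" "Gamma_inf \<notin> T"
  obtains b where "b \<noteq> 0" "qchar (-3 * b) = i" "card {\<pi> \<in> T. l \<subseteq> \<pi>} = card {c. pg_plane 1 0 b c \<in> T}"
proof -
  obtain A b where A: "A \<in> cubic_stab" "act A l = Gamma_inf \<inter> pg_plane 1 0 b 0"
    using subsetD[OF EGamma_class_subset l] by (rule depress_EGamma_line)
  have "qchar (-3 * b) = i \<and> b \<noteq> 0"
    using l A stab_invariant_iff[OF class_inv] depressed_pencil_class_iff[OF i] by metis
  moreover have "card {\<pi> \<in> T. l \<subseteq> \<pi>} = card {c. pg_plane 1 0 b c \<in> T}"
    using card_supersets_act[OF T(1) A(1), of l] card_planes_through_depressed_pencil[OF T(2,3)]
    unfolding A(2) by simp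
  ultimately show thesis using that by blast
qed

end

section \<open>Incidence numbers\<close>

text \<open>Translation by 1 permutes the field, so the sum of all elements does not change when q
  times 1 is added.\<close>

lemma of_nat_CARD_eq_0: "of_nat CARD('a::{field,finite}) = (0::'a)"
proof -
  have "(\<Sum>x\<in>UNIV. x) = (\<Sum>x\<in>UNIV. x + (1::'a))"
    by (rule sum.reindex_bij_betw[symmetric]) (auto intro: bij_betw_byWitness[where f' = "\<lambda>x. x - 1"])
  then show ?thesis by (simp add: sum.distrib)
qed

text \<open>In the field q is 0. If 2 or 3 were 0 as well, the nonzero remainder of q would vanish
  too, and hence 1.\<close>

lemma twisted_cubic_field_if_coprime_6:
  assumes "5 \<le> CARD('a::{field,finite})" "odd CARD('a)" "\<not> 3 dvd CARD('a)"
  shows "twisted_cubic_field TYPE('a)"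
proof
  show "(2::'a) \<noteq> 0"
  proof
    assume "(2::'a) = 0"
    obtain k where "CARD('a) = 2 * k + 1" using assms(2) by (rule oddE)
    then have "of_nat CARD('a) = 2 * of_nat k + (1::'a)" by simp
    with \<open>(2::'a) = 0\<close> show False by (simp add: of_nat_CARD_eq_0)
  qed
  show "(3::'a) \<noteq> 0"
  proof
    assume three: "(3::'a) = 0"
    have "CARD('a) mod 3 = 1 \<or> CARD('a) mod 3 = 2" using assms(3) by presburger
    moreover have "of_nat CARD('a) = 3 * of_nat (CARD('a) div 3) + (of_nat (CARD('a) mod 3) :: 'a)"
      by (metis mult_div_mod_eq of_nat_add of_nat_mult of_nat_numeral)
    ultimately have "(1::'a) = 0 \<or> (2::'a) = 0" using three by (auto simp: of_nat_CARD_eq_0)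
    then have "(3::'a) = 1 \<or> (3::'a) - 1 = 0" by auto
    with three show False by simp
  qed
qed (fact assms(1))

context twisted_cubic_field
begin

lemma Pi_num_C_planes:
  assumes i: "i \<in> {1, -1}"
  defines "q \<equiv> real CARD('a)" and "X \<equiv> real_of_int (qchar (-3::'a))"
  shows "Pi_num (C_planes 2) (EGamma_class i :: ('a^4) set set) (1 + real_of_int i)"
    and "Pi_num (C_planes 3) (EGamma_class i :: ('a^4) set set) ((q - X - 3 * (1 + real_of_int i)) / 6)"
    and "Pi_num (C_planes 0) (EGamma_class i :: ('a^4) set set) ((q - X) / 3)"
    and "Pi_num bar1_C_planes (EGamma_class i :: ('a^4) set set) ((q + X - (1 + real_of_int i)) / 2)"
proof -
  have C: "\<exists>b::'a. b \<noteq> 0 \<and> qchar (-3 * b) = i \<and>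
      card {\<pi> \<in> C_planes d. l \<subseteq> \<pi>} = card {c. card (cubic_roots b c) = d}"
    if l: "l \<in> (EGamma_class i :: ('a^4) set set)" and "d \<noteq> 1" for l d
  proof -
    obtain b :: 'a where "b \<noteq> 0" "qchar (-3 * b) = i"
      "card {\<pi> \<in> C_planes d. l \<subseteq> \<pi>} = card {c. pg_plane 1 0 b c \<in> C_planes d}"
      by (rule card_planes_through_EGamma_class[OF i l stab_invariant_C_planes C_planes_subset
        Gamma_inf_notin_C_planes[OF \<open>d \<noteq> 1\<close>]])
    then show ?thesis unfolding depressed_in_C_planes_iff by (intro exI[of _ b] conjI)
  qed
  show "Pi_num (C_planes 2) (EGamma_class i :: ('a^4) set set) (1 + real_of_int i)"
    unfolding Pi_num_def
  proof
    fix l :: "('a^4) set" assume "l \<in> EGamma_class i"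
    then obtain b :: 'a where b: "b \<noteq> 0" "qchar (-3 * b) = i"
      "card {\<pi> \<in> C_planes 2. l \<subseteq> \<pi>} = card {c. card (cubic_roots b c) = 2}" using C[of l 2] by auto
    then have "int (card {\<pi> \<in> C_planes 2. l \<subseteq> \<pi>}) = 1 + i"
      using cubic_counts(1)[OF b(1)] by (simp only:)
    from arg_cong[OF this, of real_of_int] show "real (card {\<pi> \<in> C_planes 2. l \<subseteq> \<pi>}) = 1 + real_of_int i" by simp
  qed
  show "Pi_num (C_planes 3) (EGamma_class i :: ('a^4) set set) ((q - X - 3 * (1 + real_of_int i)) / 6)"
    unfolding Pi_num_def
  proof
    fix l :: "('a^4) set" assume "l \<in> EGamma_class i"
    then obtain b :: 'a where b: "b \<noteq> 0" "qchar (-3 * b) = i"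
      "card {\<pi> \<in> C_planes 3. l \<subseteq> \<pi>} = card {c. card (cubic_roots b c) = 3}" using C[of l 3] by auto
    then have "6 * int (card {\<pi> \<in> C_planes 3. l \<subseteq> \<pi>}) = int CARD('a) - qchar (-3::'a) - 3 * (1 + i)"
      using cubic_counts(1,2)[OF b(1)] by (simp only:)
    from arg_cong[OF this, of real_of_int] show "real (card {\<pi> \<in> C_planes 3. l \<subseteq> \<pi>}) = (q - X - 3 * (1 + real_of_int i)) / 6"
      unfolding q_def X_def by simp
  qed
  show "Pi_num (C_planes 0) (EGamma_class i :: ('a^4) set set) ((q - X) / 3)"
    unfolding Pi_num_def
  proof
    fix l :: "('a^4) set" assume "l \<in> EGamma_class i"
    then obtain b :: 'a where b: "b \<noteq> 0" "qchar (-3 * b) = i"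
      "card {\<pi> \<in> C_planes 0. l \<subseteq> \<pi>} = card {c. card (cubic_roots b c) = 0}" using C[of l 0] by auto
    then have "3 * int (card {\<pi> \<in> C_planes 0. l \<subseteq> \<pi>}) = int CARD('a) - qchar (-3::'a)"
      using cubic_counts(4)[OF b(1)] by (simp only:)
    from arg_cong[OF this, of real_of_int] show "real (card {\<pi> \<in> C_planes 0. l \<subseteq> \<pi>}) = (q - X) / 3"
      unfolding q_def X_def by simp
  qed
  show "Pi_num bar1_C_planes (EGamma_class i :: ('a^4) set set) ((q + X - (1 + real_of_int i)) / 2)"
    unfolding Pi_num_def
  proof
    fix l :: "('a^4) set" assume l: "l \<in> EGamma_class i"
    have "stab_invariant (bar1_C_planes :: ('a^4) set set)"
      unfolding bar1_C_planes_def by (rule stab_invariant_diff[OF stab_invariant_C_planes Gamma_inv])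
    moreover have "bar1_C_planes \<subseteq> (pg_planes :: ('a^4) set set)"
      unfolding bar1_C_planes_def by (rule order_trans[OF Diff_subset C_planes_subset])
    moreover have "Gamma_inf \<notin> (bar1_C_planes :: ('a^4) set set)"
      unfolding bar1_C_planes_def using Gamma_inf_in by blast
    ultimately obtain b :: 'a where b: "b \<noteq> 0" "qchar (-3 * b) = i"
      "card {\<pi> \<in> bar1_C_planes. l \<subseteq> \<pi>} = card {c. pg_plane 1 0 b c \<in> bar1_C_planes}"
      by (rule card_planes_through_EGamma_class[OF i l])
    have "pg_plane 1 0 b c \<in> bar1_C_planes \<longleftrightarrow> card (cubic_roots b c) = 1" for c
      using b(1) by (simp add: bar1_C_planes_def depressed_in_C_planes_iff depressed_in_Gamma_planes_iff)
    then have "2 * int (card {\<pi> \<in> bar1_C_planes. l \<subseteq> \<pi>}) = int CARD('a) + qchar (-3::'a) - (1 + i)"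
      using cubic_counts(1,3)[OF b(1)] b(2,3) by (simp only:)
    from arg_cong[OF this, of real_of_int] show "real (card {\<pi> \<in> bar1_C_planes. l \<subseteq> \<pi>}) = (q + X - (1 + real_of_int i)) / 2"
      unfolding q_def X_def by simp
  qed
qed

text \<open>The doubled integer count m postpones division to the reals; a general T also covers
  \<open>bar1_C_planes\<close>.\<close>

lemma Lambda_num_C_planes:
  assumes i: "i \<in> {1, -1}" and T: "T \<subseteq> C_planes d - (Gamma_planes :: ('a^4) set set)"
    and count: "\<And>b c :: 'a. b \<noteq> 0 \<or> c \<noteq> 0 \<Longrightarrow> card (cubic_roots b c) = d \<Longrightarrow>
      2 * pencil_count i b c = m"
    and r: "real_of_int m = 2 * r"
  shows "Lambda_num (EGamma_class i) T r"
  unfolding Lambda_num_def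
proof
  fix \<pi> assume "\<pi> \<in> T"
  then have "\<pi> \<in> C_planes d" "\<pi> \<notin> Gamma_planes" using T by blast+
  from card_EGamma_class_in_plane[OF i this]
  obtain b c where "b \<noteq> 0 \<or> c \<noteq> 0" "card (cubic_roots b c) = d"
    "int (card {l \<in> EGamma_class i. l \<subseteq> \<pi>}) = pencil_count i b c" .
  then have "2 * int (card {l \<in> EGamma_class i. l \<subseteq> \<pi>}) = m" using count by simp
  from arg_cong[OF this, of real_of_int] r show "real (card {l \<in> EGamma_class i. l \<subseteq> \<pi>}) = r" by simp
qed

lemma C_planes_disjoint_Gamma: "d \<noteq> 1 \<Longrightarrow> C_planes d \<subseteq> C_planes d - (Gamma_planes :: ('a^4) set set)"
  using Gamma_planes_subset_C_planes by (auto simp: C_planes_def)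

lemma Lambda_num_values:
  defines "q \<equiv> real CARD('a)" and "X \<equiv> real_of_int (qchar (-3::'a))"
  shows "Lambda_num (EGamma_class 1) (C_planes 0 :: ('a^4) set set) ((q - X) / 2)"
    and "Lambda_num (EGamma_class (-1)) (C_planes 0 :: ('a^4) set set) ((q - X) / 2)"
    and "Lambda_num (EGamma_class 1) (bar1_C_planes :: ('a^4) set set) ((q + X - 2) / 2)"
    and "Lambda_num (EGamma_class (-1)) (bar1_C_planes :: ('a^4) set set) ((q + X) / 2)"
    and "Lambda_num (EGamma_class 1) (C_planes 2 :: ('a^4) set set) (q - 1)"
    and "Lambda_num (EGamma_class (-1)) (C_planes 2 :: ('a^4) set set) 0"
    and "Lambda_num (EGamma_class 1) (C_planes 3 :: ('a^4) set set) ((q - X - 6) / 2)"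
    and "Lambda_num (EGamma_class (-1)) (C_planes 3 :: ('a^4) set set) ((q - X) / 2)"
proof -
  show "Lambda_num (EGamma_class 1) (C_planes 0 :: ('a^4) set set) ((q - X) / 2)"
    by (rule Lambda_num_C_planes[where d = 0 and m = "int CARD('a) - qchar (-3::'a)"])
      (simp_all add: pencil_counts C_planes_disjoint_Gamma q_def X_def)
  show "Lambda_num (EGamma_class (-1)) (C_planes 0 :: ('a^4) set set) ((q - X) / 2)"
    by (rule Lambda_num_C_planes[where d = 0 and m = "int CARD('a) - qchar (-3::'a)"])
      (simp_all add: pencil_counts C_planes_disjoint_Gamma q_def X_def)
  show "Lambda_num (EGamma_class 1) (bar1_C_planes :: ('a^4) set set) ((q + X - 2) / 2)"
    unfolding bar1_C_planes_def
    by (rule Lambda_num_C_planes[where d = 1 and m = "int CARD('a) + qchar (-3::'a) - 2"])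
      (simp_all add: pencil_counts C_planes_disjoint_Gamma q_def X_def)
  show "Lambda_num (EGamma_class (-1)) (bar1_C_planes :: ('a^4) set set) ((q + X) / 2)"
    unfolding bar1_C_planes_def
    by (rule Lambda_num_C_planes[where d = 1 and m = "int CARD('a) + qchar (-3::'a)"])
      (simp_all add: pencil_counts C_planes_disjoint_Gamma q_def X_def)
  show "Lambda_num (EGamma_class 1) (C_planes 2 :: ('a^4) set set) (q - 1)"
    by (rule Lambda_num_C_planes[where d = 2 and m = "2 * (int CARD('a) - 1)"])
      (simp_all add: pencil_counts C_planes_disjoint_Gamma q_def X_def)
  show "Lambda_num (EGamma_class (-1)) (C_planes 2 :: ('a^4) set set) 0"
    by (rule Lambda_num_C_planes[where d = 2 and m = "0"])
      (simp_all add: pencil_counts C_planes_disjoint_Gamma q_def X_def)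
  show "Lambda_num (EGamma_class 1) (C_planes 3 :: ('a^4) set set) ((q - X - 6) / 2)"
    by (rule Lambda_num_C_planes[where d = 3 and m = "int CARD('a) - qchar (-3::'a) - 6"])
      (simp_all add: pencil_counts C_planes_disjoint_Gamma q_def X_def)
  show "Lambda_num (EGamma_class (-1)) (C_planes 3 :: ('a^4) set set) ((q - X) / 2)"
    by (rule Lambda_num_C_planes[where d = 3 and m = "int CARD('a) - qchar (-3::'a)"])
      (simp_all add: pencil_counts C_planes_disjoint_Gamma q_def X_def)
qed

lemma real_card_EGamma_class:
  assumes "i \<in> {1, -1}"
  shows "real (card (EGamma_class i :: ('a^4) set set)) = (real CARD('a) ^ 3 - real CARD('a)) / 2"
proof -
  have "real (2 * card (EGamma_class i :: ('a^4) set set)) = real ((CARD('a) + 1) * (CARD('a) * (CARD('a) - 1)))"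
    unfolding card_EGamma_class[OF assms] ..
  also have "\<dots> = (real CARD('a) + 1) * (real CARD('a) * (real CARD('a) - 1))"
  proof -
    have "real (CARD('a) - 1) = real CARD('a) - 1" using q5 by (simp add: of_nat_diff)
    then show ?thesis by (simp only: of_nat_mult of_nat_add of_nat_1)
  qed
  also have "\<dots> = real CARD('a) ^ 3 - real CARD('a)"
    by (simp add: power3_eq_cube algebra_simps)
  finally show ?thesis by simp
qed

lemma Gq_orbits_EGamma_lines:
  "Gq_orbit ` (EGamma_lines :: ('a^4) set set) = {EGamma_class (-1), EGamma_class 1}"
proof -
  have "Gq_orbit ` (EGamma_class i :: ('a^4) set set) = {EGamma_class i}" if "i \<in> {1, -1}" for i
  proof -
    have "Gq_orbit ` (EGamma_class i :: ('a^4) set set) = (\<lambda>_. EGamma_class i) ` (EGamma_class i :: ('a^4) set set)"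
      by (intro image_cong refl Gq_orbit_EGamma_class[OF that])
    then show ?thesis using EGamma_class_nonempty[OF that] by (simp only: image_constant_conv if_False)
  qed
  then have "Gq_orbit ` (EGamma_class 1 :: ('a^4) set set) = {EGamma_class 1}"
    "Gq_orbit ` (EGamma_class (-1) :: ('a^4) set set) = {EGamma_class (-1)}" by simp_all
  then show ?thesis unfolding EGamma_lines_eq image_Un by (simp only: Un_insert_right Un_empty_right)
qed

lemma EGamma_classes_distinct: "EGamma_class (-1) \<noteq> (EGamma_class 1 :: ('a^4) set set)"
proof
  assume eq: "EGamma_class (-1) = (EGamma_class 1 :: ('a^4) set set)"
  obtain l :: "('a^4) set" where "l \<in> EGamma_class 1" using EGamma_class_nonempty[of 1] by blast
  moreover from this have "l \<in> EGamma_class (-1)" unfolding eq .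
  ultimately show False by (simp add: EGamma_class_def)
qed

end

theorem theorem7p6:
  fixes q :: nat and \<xi> :: int
  assumes "q = CARD('a::{field,finite})" and "q \<ge> 5" and "odd q"
    and "\<xi> \<in> {1, -1}" and "[int q = \<xi>] (mod 3)"
  shows "\<exists>O1 O2 :: ('a ^ 4) set set.
    O1 \<noteq> O2 \<and>
    Gq_orbit ` EGamma_lines = {O1, O2} \<and>
    real (card O1) = (real q ^ 3 - real q) / 2 \<and>
    real (card O2) = (real q ^ 3 - real q) / 2 \<and>
    Pi_num (C_planes 2) O1 0 \<and>
    Lambda_num O1 (C_planes 2) 0 \<and>
    Pi_num (C_planes 2) O2 2 \<and>
    Lambda_num O2 (C_planes 2) (real q - 1) \<and>
    Pi_num (C_planes 3) O1 ((real q - real_of_int \<xi>) / 6) \<and>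
    Lambda_num O1 (C_planes 3) ((real q - real_of_int \<xi>) / 2) \<and>
    Lambda_num O1 (C_planes 0) ((real q - real_of_int \<xi>) / 2) \<and>
    Lambda_num O2 (C_planes 0) ((real q - real_of_int \<xi>) / 2) \<and>
    Pi_num (C_planes 0) O1 ((real q - real_of_int \<xi>) / 3) \<and>
    Pi_num (C_planes 0) O2 ((real q - real_of_int \<xi>) / 3) \<and>
    Pi_num bar1_C_planes O1 ((real q + real_of_int \<xi>) / 2) \<and>
    Lambda_num O1 bar1_C_planes ((real q + real_of_int \<xi>) / 2) \<and>
    Pi_num bar1_C_planes O2 ((real q + real_of_int \<xi> - 2) / 2) \<and>
    Lambda_num O2 bar1_C_planes ((real q + real_of_int \<xi> - 2) / 2) \<and>
    Pi_num (C_planes 3) O2 ((real q - real_of_int \<xi> - 6) / 6) \<and>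
    Lambda_num O2 (C_planes 3) ((real q - real_of_int \<xi> - 6) / 2)"
proof -
  have xi: "\<xi> = 1 \<or> \<xi> = -1" using assms(4) by auto
  have "\<not> 3 dvd CARD('a)"
  proof
    assume "3 dvd CARD('a)"
    then have "3 dvd int q" using assms(1) by presburger
    then have "3 dvd \<xi>" using assms(5) cong_dvd_iff by blast
    with xi show False by auto
  qed
  then interpret twisted_cubic_field "TYPE('a)"
    using assms(1-3) by (intro twisted_cubic_field_if_coprime_6) simp_all
  \<comment> \<open>Both are 1 or -1 and congruent to q modulo 3, where 1 and -1 differ.\<close>
  have X: "qchar (-3::'a) = \<xi>"
  proof -
    have "[qchar (-3::'a) = \<xi>] (mod 3)"
      using cong_trans[OF cong_sym[OF qchar_minus_3_cong]] assms(1,5) by simp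
    then have "3 dvd qchar (-3::'a) - \<xi>" by (simp add: cong_iff_dvd_diff)
    moreover have "qchar (-3::'a) \<noteq> 0" unfolding qchar_eq_0_iff by simp
    ultimately show ?thesis using xi qchar_values[of "-3::'a"] by auto
  qed
  have i: "1 \<in> {1, -1::int}" "-1 \<in> {1, -1::int}" by simp_all
  have v: "1 + real_of_int (-1) = 0" "1 + real_of_int 1 = 2" "3 * (0::real) = 0" "3 * (2::real) = 6"
    by simp_all
  note eqs = X v diff_0_right assms(1)[symmetric]
  \<comment> \<open>The class -1, whose lines lie in no plane with exactly two points of the cubic,
    is the orbit \<open>O1\<close>.\<close>
  show ?thesis
    by (intro exI[of _ "EGamma_class (-1)"] exI[of _ "EGamma_class 1"] conjI)
      (rule EGamma_classes_distinct Gq_orbits_EGamma_lines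
        real_card_EGamma_class[OF i(1), unfolded eqs] real_card_EGamma_class[OF i(2), unfolded eqs]
        Pi_num_C_planes[OF i(1), unfolded eqs] Pi_num_C_planes[OF i(2), unfolded eqs]
        Lambda_num_values[unfolded eqs])+
qed

end
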